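(* Let $IMC$ be an infinite magic carpet graph with projective plane identifications, and let $x$ be a cell (vertex) of $IMC$. Then there are constants $c, C>0$ such that, for all large enough $r$, \[ c\left(\frac{r}{\log r}\right)^3 \le \# B(x,r) \le C\, r^3 . \]
   Context: Complex $V_m$. For $m\ge 0$ divide $Q_m=[0,3^m]^2$ into closed unit squares $[a,a+1]\times[b,b+1]$, $0\le a,b<3^m$ integers with base-3 digits $a=\sum_{j<m} a_j3^j$, $b=\sum_{j<m} b_j3^j$. The cells are the $8^m$ unit squares with $(a_j,b_j)\ne(1,1)$ for all $j<m$. The deleted region is the union of the vacant squares: a vacant square of side $s=3^j$ ($0\le j\le m-1$) is the central $3^j\times 3^j$ subsquare of a triadic block of side $3^{j+1}$, the block not being contained in a larger vacant square. With projective plane identifications, for every vacant square $[p,p+s]\times[q,q+s]$ both pairs of opposite sides are identified with reversed orientation: $(p,q+t)\sim(p+s,q+s-t)$ and $(p+t,q)\sim(p+s-t,q+s)$ for $0\le t\le s$. The outer boundary of $Q_m$ is not identified. The result is $V_m$; it is also regarded as a graph whose vertices are the cells, two cells being adjacent when they share a unit edge after identification. Infinite magic carpet. $V_{m+1}$ consists of eight copies of $V_m$ around a central vacant square of side $3^m$. For each $m$ choose one of the eight embeddings $V_m\subseteq V_{m+1}$; $IMC$ is the union of $V_0\subseteq V_1\subseteq V_2\subseteq\cdots$. The choices are assumed generic, so that there is no outer boundary (the outer squares exhaust the plane); thus $IMC$ is an infinite 4-regular graph on its cells. Distance. $d(x,y)$ is the length (number of steps) of a shortest path of successively adjacent cells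 from $x$ to $y$, and $B(x,r)=\{y : y \text{ is a cell of } IMC,\ d(x,y)<r\}$; $\#$ denotes cardinality. *)

theory Defs
  imports Complex_Main "HOL-Library.Product_Plus" "HOL-Library.Extended_Real"
begin

text \<open>A cell \<open>[a, a + 1] \<times> [b, b + 1]\<close> is represented by its lower left corner \<open>(a, b)\<close>.\<close>

type_synonym cell = "int \<times> int"

definition square :: "int \<Rightarrow> int \<Rightarrow> int \<Rightarrow> (real \<times> real) set" where
  "square p q s = {of_int p..of_int (p + s)} \<times> {of_int q..of_int (q + s)}"

definition cells :: "nat \<Rightarrow> cell set" where
  "cells m = {(a, b). 0 \<le> a \<and> a < 3 ^ m \<and> 0 \<le> b \<and> b < 3 ^ m \<and>
     (\<forall>j<m. (a div 3 ^ j mod 3, b div 3 ^ j mod 3) \<noteq> (1, 1))}"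

text \<open>\<open>vacant m j p q\<close>: the square with lower left corner \<open>(p, q)\<close> and side \<open>3 ^ j\<close> is vacant
  in \<open>Q\<^sub>m\<close>.  The witnesses \<open>a\<close>, \<open>b\<close> give the lower left corner of the triadic block of side
  \<open>3 ^ (j + 1)\<close> whose centre it is; the recursion goes through the larger vacant squares.\<close>

context
  notes conj_cong [fundef_cong]
begin

function vacant :: "nat \<Rightarrow> nat \<Rightarrow> int \<Rightarrow> int \<Rightarrow> bool" where
  "vacant m j p q \<longleftrightarrow> j < m \<and>
     (\<exists>a b. 3 ^ (j + 1) dvd a \<and> 3 ^ (j + 1) dvd b \<and>
        square a b (3 ^ (j + 1)) \<subseteq> square 0 0 (3 ^ m) \<and>
        p = a + 3 ^ j \<and> q = b + 3 ^ j \<and>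
        \<not> (\<exists>k p' q'. j < k \<and> vacant m k p' q' \<and>
              square a b (3 ^ (j + 1)) \<subseteq> square p' q' (3 ^ k)))"
  by pat_completeness auto
termination
  by (relation "measure (\<lambda>(m, j, p, q). m - j)") auto

end

declare vacant.simps [simp del]

text \<open>The projective plane identifications of boundary points of vacant squares.\<close>

inductive glue :: "nat \<Rightarrow> real \<times> real \<Rightarrow> real \<times> real \<Rightarrow> bool" for m :: nat where
  horizontal: "vacant m j p q \<Longrightarrow> 0 \<le> t \<Longrightarrow> t \<le> 3 ^ j \<Longrightarrow>
     glue m (of_int p, of_int q + t) (of_int p + 3 ^ j, of_int q + 3 ^ j - t)"
| vertical: "vacant m j p q \<Longrightarrow> 0 \<le> t \<Longrightarrow> t \<le> 3 ^ j \<Longrightarrow>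
     glue m (of_int p + t, of_int q) (of_int p + 3 ^ j - t, of_int q + 3 ^ j)"

definition quotient_map :: "nat \<Rightarrow> real \<times> real \<Rightarrow> (real \<times> real) set" where
  "quotient_map m u = {v. equivclp (glue m) u v}"

definition edges :: "cell \<Rightarrow> (real \<times> real) set set" where
  "edges c = (case c of (a, b) \<Rightarrow>
     {{of_int a} \<times> {of_int b..of_int b + 1}, {of_int a + 1} \<times> {of_int b..of_int b + 1},
      {of_int a..of_int a + 1} \<times> {of_int b}, {of_int a..of_int a + 1} \<times> {of_int b + 1}})"

definition adjV :: "nat \<Rightarrow> cell \<Rightarrow> cell \<Rightarrow> bool" where
  "adjV m c d \<longleftrightarrow> c \<in> cells m \<and> d \<in> cells m \<and> c \<noteq> d \<and>
     (\<exists>E\<in>edges c. \<exists>F\<in>edges d. quotient_map m ` E = quotient_map m ` F)"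

text \<open>A choice \<open>e m \<noteq> (1, 1)\<close> embeds \<open>V\<^sub>m\<close> into \<open>V\<^sub>m\<^sub>+\<^sub>1\<close> by translation by \<open>3 ^ m\<close> times \<open>e m\<close>.
  The union is realised in the plane with \<open>V\<^sub>0 = [0, 1] \<times> [0, 1]\<close>; then \<open>V\<^sub>m\<close> occupies the
  translate of \<open>Q\<^sub>m\<close> with lower left corner \<open>origin e m\<close>.\<close>

definition embedding_choice :: "(nat \<Rightarrow> int \<times> int) \<Rightarrow> bool" where
  "embedding_choice e \<longleftrightarrow> (\<forall>m. e m \<in> {0, 1, 2} \<times> {0, 1, 2} - {(1, 1)})"

definition origin :: "(nat \<Rightarrow> int \<times> int) \<Rightarrow> nat \<Rightarrow> int \<times> int" where
  "origin e m = - (\<Sum>k<m. (3 ^ k * fst (e k), 3 ^ k * snd (e k)))"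

definition generic :: "(nat \<Rightarrow> int \<times> int) \<Rightarrow> bool" where
  "generic e \<longleftrightarrow> (\<Union>m. square (fst (origin e m)) (snd (origin e m)) (3 ^ m)) = UNIV"

definition IMC :: "(nat \<Rightarrow> int \<times> int) \<Rightarrow> cell set" where
  "IMC e = {x. \<exists>m. x - origin e m \<in> cells m}"

definition adjIMC :: "(nat \<Rightarrow> int \<times> int) \<Rightarrow> cell \<Rightarrow> cell \<Rightarrow> bool" where
  "adjIMC e x y \<longleftrightarrow> (\<exists>m. adjV m (x - origin e m) (y - origin e m))"

definition distIMC :: "(nat \<Rightarrow> int \<times> int) \<Rightarrow> cell \<Rightarrow> cell \<Rightarrow> enat" where
  "distIMC e x y = (INF n\<in>{n. (adjIMC e ^^ n) x y}. enat n)"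

definition ballIMC :: "(nat \<Rightarrow> int \<times> int) \<Rightarrow> cell \<Rightarrow> real \<Rightarrow> cell set" where
  "ballIMC e x r = {y \<in> IMC e. ereal_of_enat (distIMC e x y) < ereal r}"

end

theory Submission
  imports Defs
begin

text \<open>
  Both identifications at a vacant square \<open>h\<close> are restrictions of one map: the point reflection in
  the centre of \<open>h\<close>, applied to the boundary of \<open>h\<close>.  Everything below rests on this.

  \<^emph>\<open>Lower bound.\<close>  Opposite corners of a vacant square are identified, so the central vacant square
  of \<open>V\<^sub>m\<^sub>+\<^sub>1\<close> can be crossed from corner to opposite corner in three steps.  A diagonal of \<open>V\<^sub>m\<^sub>+\<^sub>1\<close>
  is thus two diagonals of copies of \<open>V\<^sub>m\<close> and three steps, which makes it at most \<open>3 (2\<^sup>m - 1)\<close>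
  steps long in \<open>V\<^sub>m\<close> (\<open>corner_diagonal\<close>).  A side of \<open>V\<^sub>m\<^sub>+\<^sub>1\<close> is two diagonals of copies and only one side of a
  copy, so it is \<open>O(2\<^sup>m)\<close> as well (\<open>corner_side_horizontal\<close>, \<open>corner_side_vertical\<close>).  Moving a cell
  to a corner of its copy of \<open>V\<^sub>m\<close>, and from there along sides to a corner of \<open>V\<^sub>m\<^sub>+\<^sub>1\<close>, gives a
  geometric series: the diameter of \<open>V\<^sub>m\<close> is at most \<open>56 \<cdot> 2\<^sup>m\<close> (\<open>diameter_le\<close>).  A ball of radius
  comparable to \<open>2\<^sup>m\<close> therefore contains all \<open>8\<^sup>m\<close> cells of \<open>V\<^sub>m\<close>, that is, at least \<open>c r\<^sup>3\<close> cells,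
  and \<open>r / ln r \<le> r\<close> as soon as \<open>r \<ge> exp 1\<close>.

  \<^emph>\<open>Upper bound.\<close>  Cut \<open>V\<^sub>M\<close> into triadic blocks of side \<open>3\<^sup>m\<close>.  Let \<open>Z\<close> consist of
  the four corners of the block in which a path starts and of the points identified with them.  If
  the path is shorter than \<open>2\<^sup>m / 4\<close>, it does not leave the blocks around \<open>Z\<close>.  To see this, consider
  \<open>min\<^sub>z max (\<kappa> (u\<^sub>1 - z\<^sub>1)) (\<kappa> (u\<^sub>2 - z\<^sub>2))\<close>, the minimum over \<open>z \<in> Z\<close>, where \<open>\<kappa>\<close> is an even
  Cantor staircase that rises from \<open>0\<close> to \<open>2\<^sup>m\<close> on \<open>[0, 3\<^sup>m]\<close> and is constant afterwards.  The
  staircase is constant across vacant squares inside a block, and a larger vacant square has its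
  boundary on the block grid, where reflecting it also reflects \<open>Z\<close>; hence this potential respects
  all identifications (\<open>potential_antipode\<close>).  It changes by at most \<open>2\<close> in a step, is at most
  \<open>2\<^sup>m / 2\<close> at the start, and equals \<open>2\<^sup>m\<close> away from the blocks around \<open>Z\<close>.  Closed vacant squares are
  disjoint (\<open>hole_unique\<close>), so no lattice point is identified with more than one other; thus \<open>Z\<close> has
  at most \<open>8\<close> points, and at most \<open>32 \<cdot> 8\<^sup>m\<close> cells can be reached (\<open>card_reachable_le\<close>).

  The bounds are uniform in the size of the ambient \<open>V\<^sub>M\<close>, so they pass to the union \<open>IMC\<close>.
\<close>

section \<open>Vacant squares in terms of base-3 digits\<close>

lemma square_subset_iff:
  assumes "0 \<le> s"
  shows "square a b s \<subseteq> square p q t \<longleftrightarrow>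
    p \<le> a \<and> a + s \<le> p + t \<and> q \<le> b \<and> b + s \<le> q + t"
  using assms unfolding square_def times_subset_iff by (auto simp flip: of_int_add)

text \<open>One coordinate of the condition that \<open>[p, p + 3\<^sup>j]\<close> is the middle third of a triadic interval of
  length \<open>3\<^sup>j\<^sup>+\<^sup>1\<close> in \<open>[0, 3\<^sup>m]\<close>.\<close>

definition central :: "nat \<Rightarrow> nat \<Rightarrow> int \<Rightarrow> bool" where
  "central m j p \<longleftrightarrow> 3 ^ (j + 1) dvd p - 3 ^ j \<and> 3 ^ j \<le> p \<and> p + 2 * 3 ^ j \<le> 3 ^ m"

text \<open>The block is determined by \<open>p\<close> and \<open>q\<close>, which turns the recursive description
  into inequalities between integers.\<close>

lemma vacant_unfold:
  "vacant m j p q \<longleftrightarrow> j < m \<and> central m j p \<and> central m j q \<and>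
     \<not> (\<exists>k p' q'. j < k \<and> vacant m k p' q' \<and>
          p' \<le> p - 3 ^ j \<and> p + 2 * 3 ^ j \<le> p' + 3 ^ k \<and>
          q' \<le> q - 3 ^ j \<and> q + 2 * 3 ^ j \<le> q' + 3 ^ k)"
proof -
  have corner: "x = a + 3 ^ j \<longleftrightarrow> a = x - 3 ^ j" for x a :: int by auto
  have side: "x - 3 ^ j + 3 * 3 ^ j = x + 2 * (3::int) ^ j" for x by simp
  have sub: "square a b (3 * 3 ^ j) \<subseteq> square p' q' t \<longleftrightarrow>
      p' \<le> a \<and> a + 3 * 3 ^ j \<le> p' + t \<and> q' \<le> b \<and> b + 3 * 3 ^ j \<le> q' + t" for a b p' q' t
    by (rule square_subset_iff) simp
  have one_point: "(\<exists>a b. A a \<and> B b \<and> R a b \<and> a = u \<and> b = v \<and> S a b) \<longleftrightarrow> A u \<and> B v \<and> R u v \<and> S u v"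
    for A B :: "int \<Rightarrow> bool" and R S u v by auto
  show ?thesis
    by (subst vacant.simps, simp only: corner one_point power_add power_one_right
         mult.commute [of _ 3] sub side)
      (auto simp: central_def)
qed

lemma nonneg_of_dvd:
  fixes d x :: int
  assumes "d dvd x" "- d < x"
  shows "0 \<le> x"
proof (cases "d \<le> 0")
  case False
  obtain k where k: "x = d * k" using assms(1) by blast
  have "- 1 < k"
  proof (rule ccontr)
    assume "\<not> - 1 < k"
    then have "d * k \<le> d * (- 1)" using False by (intro mult_left_mono) auto
    then show False using assms(2) k by simp
  qed
  then show ?thesis using False k by simp
qed (use assms in auto)

text \<open>Triadic intervals are nested or have disjoint interiors.  Here the middle third of an interval meets
  a larger triadic interval, so the whole interval lies in it.\<close>

lemma central_inside:
  assumes "central m j p" "j < k" "3 ^ k dvd p'" "p' \<le> p + 3 ^ j" "p \<le> p' + 3 ^ k"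
  shows "p' \<le> p - 3 ^ j" "p + 2 * 3 ^ j \<le> p' + 3 ^ k"
proof -
  have d: "(3::int) ^ (j + 1) dvd 3 ^ k" using assms(2) by (intro le_imp_power_dvd) simp
  have c: "3 ^ (j + 1) dvd p - 3 ^ j" using assms(1) by (simp add: central_def)
  have pos: "(0::int) < 3 ^ j" by simp
  have e: "3 ^ (j + 1) dvd p'" using d assms(3) by (rule dvd_trans)
  have 1: "3 ^ (j + 1) dvd p - 3 ^ j - p'" using c e by (rule dvd_diff)
  show "p' \<le> p - 3 ^ j" using nonneg_of_dvd [OF 1] pos assms(4) by simp
  have "3 ^ (j + 1) dvd (p' + 3 ^ k) - (p - 3 ^ j) - 3 ^ (j + 1)"
    by (rule dvd_diff [OF dvd_diff [OF dvd_add [OF e d] c] dvd_refl])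
  from nonneg_of_dvd [OF this] show "p + 2 * 3 ^ j \<le> p' + 3 ^ k" using pos assms(5) by simp
qed

lemma central_digit:
  assumes "central m k p'" "p' \<le> p" "p < p' + 3 ^ k"
  shows "p div 3 ^ k mod 3 = 1"
proof -
  obtain A where A: "p' - 3 ^ k = 3 ^ (k + 1) * A" using assms(1) by (auto simp: central_def)
  have "p div 3 ^ k = 3 * A + 1"
    using A assms(2,3) by (intro int_div_pos_eq [of _ _ _ "p - p'"]) (auto simp: algebra_simps)
  then show ?thesis by simp
qed

text \<open>A digit \<open>1\<close> at place \<open>k\<close> says exactly that \<open>p\<close> lies in the middle third of its triadic interval of
  length \<open>3\<^sup>k\<^sup>+\<^sup>1\<close>; truncating \<open>p\<close> below that place gives the left end of that middle third.\<close>

lemma central_truncate: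
  assumes "0 \<le> p" "p < 3 ^ m" "k < m" "p div 3 ^ k mod 3 = (1::int)"
  shows "central m k (3 ^ k * (p div 3 ^ k))"
proof -
  let ?a = "p div 3 ^ k"
  have "?a - 1 = 3 * (?a div 3)" using assms(4) mult_div_mod_eq [of 3 ?a] by linarith
  then have d: "3 ^ (k + 1) dvd 3 ^ k * ?a - (3::int) ^ k"
    by (metis Suc_eq_plus1 dvd_triv_left mult.assoc power_Suc2 right_diff_distrib mult.right_neutral)
  have "0 \<le> ?a" using assms(1) by (simp add: pos_imp_zdiv_nonneg_iff)
  then have "1 \<le> ?a" using assms(4) by (metis mod_0 zless_imp_add1_zle add_0 zero_neq_one order_le_less)
  then have l: "(3::int) ^ k \<le> 3 ^ k * ?a" by simp
  have "(3::int) ^ (k + 1) dvd 3 ^ m" using assms(3) by (intro le_imp_power_dvd) simp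
  then have "(3::int) ^ (k + 1) dvd 3 ^ m - (3 ^ k * ?a - 3 ^ k) - 3 ^ (k + 1)"
    using d by (intro dvd_diff [OF dvd_diff dvd_refl])
  moreover have "- ((3::int) ^ (k + 1)) < 3 ^ m - (3 ^ k * ?a - 3 ^ k) - 3 ^ (k + 1)"
  proof -
    have "0 \<le> p mod 3 ^ k" "(0::int) < 3 ^ k" by simp_all
    then show ?thesis using assms(2) mult_div_mod_eq [of "3 ^ k" p] by linarith
  qed
  ultimately have "0 \<le> 3 ^ m - (3 ^ k * ?a - 3 ^ k) - (3::int) ^ (k + 1)"
    by (rule nonneg_of_dvd)
  then show ?thesis using d l by (simp add: central_def)
qed

lemma digit_truncate:
  assumes "k \<le> i"
  shows "3 ^ k * (p div 3 ^ k) div 3 ^ i = (p::int) div 3 ^ i"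
proof -
  obtain d where i: "i = k + d" using assms by (auto simp: le_iff_add)
  show ?thesis by (simp add: i power_add div_mult2_eq zdiv_zmult2_eq)
qed

lemma central_bounds: "central m j p \<Longrightarrow> 0 \<le> p \<and> p < 3 ^ m"
  using zero_less_power [of "3::int" j] by (auto simp: central_def simp del: zero_less_power)

text \<open>A larger vacant square swallows the block exactly when both coordinates have the digit \<open>1\<close> at a
  common higher place.  The vacant square itself belongs to the highest such place: above it no pair of
  digits \<open>(1, 1)\<close> is left, so the induction hypothesis makes it vacant.\<close>

lemma vacant_iff_digits:
  "vacant m j p q \<longleftrightarrow> j < m \<and> central m j p \<and> central m j q \<and>
     (\<forall>k. j < k \<longrightarrow> k < m \<longrightarrow> (p div 3 ^ k mod 3, q div 3 ^ k mod 3) \<noteq> (1, 1))"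
proof (induction "m - j" arbitrary: j p q rule: less_induct)
  case less
  have "(\<exists>k p' q'. j < k \<and> vacant m k p' q' \<and>
          p' \<le> p - 3 ^ j \<and> p + 2 * 3 ^ j \<le> p' + 3 ^ k \<and>
          q' \<le> q - 3 ^ j \<and> q + 2 * 3 ^ j \<le> q' + 3 ^ k) \<longleftrightarrow>
        (\<exists>k. j < k \<and> k < m \<and> p div 3 ^ k mod 3 = 1 \<and> q div 3 ^ k mod 3 = 1)" (is "?L \<longleftrightarrow> ?R")
    if j: "j < m" and p: "central m j p" and q: "central m j q"
  proof
    assume ?L
    then obtain k p' q' where k: "j < k" "vacant m k p' q'"
      "p' \<le> p - 3 ^ j" "p + 2 * 3 ^ j \<le> p' + 3 ^ k"
      "q' \<le> q - 3 ^ j" "q + 2 * 3 ^ j \<le> q' + 3 ^ k" by blast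
    have c: "k < m" "central m k p'" "central m k q'" using k(2) vacant_unfold by blast+
    have pos: "(0::int) < 3 ^ j" by simp
    have "p div 3 ^ k mod 3 = 1" "q div 3 ^ k mod 3 = 1"
      using k pos by (intro central_digit [OF c(2)] central_digit [OF c(3)]; linarith)+
    then show ?R using k(1) c(1) by blast
  next
    assume ?R
    define K where "K = {k. j < k \<and> k < m \<and> p div 3 ^ k mod 3 = 1 \<and> q div 3 ^ k mod 3 = 1}"
    have K: "finite K" "K \<noteq> {}" using \<open>?R\<close> by (auto simp: K_def)
    \<comment> \<open>The highest place with digits (1, 1) belongs to the vacant square that contains the block.\<close>
    define k where "k = Max K"
    have k: "j < k" "k < m" "p div 3 ^ k mod 3 = 1" "q div 3 ^ k mod 3 = 1"
      using Max_in [OF K] by (auto simp: k_def K_def)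
    have kmax: "i \<notin> K" if "k < i" for i using Max_ge [OF K(1), of i] that by (auto simp: k_def)
    let ?p = "3 ^ k * (p div 3 ^ k)" and ?q = "3 ^ k * (q div 3 ^ k)"
    have b: "0 \<le> p" "p < 3 ^ m" "0 \<le> q" "q < 3 ^ m"
      using central_bounds [OF p] central_bounds [OF q] by auto
    have "vacant m k ?p ?q"
    proof (subst less)
      show "m - k < m - j" using k by simp
      have "(?p div 3 ^ i mod 3, ?q div 3 ^ i mod 3) \<noteq> (1, 1)" if "k < i" "i < m" for i
        using kmax [OF that(1)] that k by (simp add: digit_truncate K_def)
      then show "k < m \<and> central m k ?p \<and> central m k ?q \<and>
        (\<forall>i. k < i \<longrightarrow> i < m \<longrightarrow> (?p div 3 ^ i mod 3, ?q div 3 ^ i mod 3) \<noteq> (1, 1))"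
        using b k by (auto intro!: central_truncate)
    qed
    moreover have "3 ^ k * (x div 3 ^ k) \<le> x - 3 ^ j \<and> x + 2 * 3 ^ j \<le> 3 ^ k * (x div 3 ^ k) + 3 ^ k"
      if "central m j x" for x
    proof -
      define y where "y = 3 ^ k * (x div 3 ^ k)"
      have "x = y + x mod 3 ^ k" by (simp add: y_def)
      moreover have "0 \<le> x mod 3 ^ k" "x mod 3 ^ k < 3 ^ k" by simp_all
      moreover have "(0::int) < 3 ^ j" by simp
      ultimately have "y \<le> x + 3 ^ j" "x \<le> y + 3 ^ k" by linarith+
      moreover have "3 ^ k dvd y" by (simp add: y_def)
      ultimately have "y \<le> x - 3 ^ j \<and> x + 2 * 3 ^ j \<le> y + 3 ^ k"
        using central_inside [OF that k(1), of y] by blast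
      then show ?thesis by (simp only: y_def)
    qed
    ultimately show ?L using k(1) p q by blast
  qed
  then show ?case by (subst vacant_unfold) auto
qed

section \<open>The embeddings of the complexes\<close>

abbreviation positions :: "(int \<times> int) set" where
  "positions \<equiv> {0, 1, 2} \<times> {0, 1, 2} - {(1, 1)}"

definition offset :: "nat \<Rightarrow> int \<times> int \<Rightarrow> int \<times> int" where
  "offset m e = (3 ^ m * fst e, 3 ^ m * snd e)"

definition point :: "int \<times> int \<Rightarrow> real \<times> real" where
  "point c = (of_int (fst c), of_int (snd c))"

lemma digit_shift_low:
  assumes "k < m"
  shows "(p + 3 ^ m * i) div 3 ^ k mod 3 = p div 3 ^ k mod (3::int)"
proof -
  obtain d where m: "m = k + 1 + d" using assms less_imp_Suc_add by auto
  have "(p + 3 ^ m * i) div 3 ^ k = p div 3 ^ k + 3 * (3 ^ d * i)"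
    using div_mult_self2 [of "3 ^ k" p "3 * (3 ^ d * i)"]
    by (simp add: m power_add ac_simps)
  then show ?thesis by simp
qed

lemma digit_mod: "k < m \<Longrightarrow> x mod 3 ^ m div 3 ^ k mod 3 = x div 3 ^ k mod (3::int)"
  using digit_shift_low [of k m "x mod 3 ^ m" "x div 3 ^ m"] by simp

lemma digit_shift_top:
  assumes "0 \<le> p" "p < 3 ^ m"
  shows "(p + 3 ^ m * i) div 3 ^ m = (i::int)"
  using assms by simp

lemma central_shift:
  assumes "central m j p" "j < m" "0 \<le> i" "i \<le> 2"
  shows "central (Suc m) j (p + 3 ^ m * i)"
proof -
  have "(3::int) ^ (j + 1) dvd 3 ^ m" using assms(2) by (intro le_imp_power_dvd) simp
  then have "3 ^ (j + 1) dvd p - 3 ^ j + 3 ^ m * i"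
    using assms(1) by (auto simp: central_def intro!: dvd_add simp del: power_Suc)
  moreover have "0 \<le> 3 ^ m * i" "3 ^ m * i \<le> 3 ^ m * 2" using assms(3,4) by simp_all
  moreover have "3 ^ j \<le> p" "p + 2 * 3 ^ j \<le> 3 ^ m" using assms(1) by (auto simp: central_def)
  ultimately have "3 ^ j \<le> p + 3 ^ m * i" "p + 3 ^ m * i + 2 * 3 ^ j \<le> 3 ^ Suc m"
    and "3 ^ (j + 1) dvd p + 3 ^ m * i - 3 ^ j"
    by (auto simp only: power_Suc diff_add_eq [symmetric])
  then show ?thesis by (simp only: central_def)
qed

text \<open>The translation adds one leading digit to each coordinate, and this pair is not \<open>(1, 1)\<close>; so in
  terms of digits nothing changes.\<close>

lemma vacant_embed:
  assumes "e \<in> positions" "vacant m j p q"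
  shows "vacant (Suc m) j (p + 3 ^ m * fst e) (q + 3 ^ m * snd e)"
proof -
  have v: "j < m" "central m j p" "central m j q"
    "\<And>k. j < k \<Longrightarrow> k < m \<Longrightarrow> (p div 3 ^ k mod 3, q div 3 ^ k mod 3) \<noteq> (1, 1)"
    using assms(2) by (auto simp: vacant_iff_digits)
  have e: "0 \<le> fst e" "fst e \<le> 2" "0 \<le> snd e" "snd e \<le> 2" "(fst e mod 3, snd e mod 3) \<noteq> (1, 1)"
    using assms(1) by auto
  have "((p + 3 ^ m * fst e) div 3 ^ k mod 3, (q + 3 ^ m * snd e) div 3 ^ k mod 3) \<noteq> (1, 1)"
    if "j < k" "k < Suc m" for k
  proof (cases "k = m")
    case True
    then show ?thesis
      using e(5) central_bounds [OF v(2)] central_bounds [OF v(3)] by (simp add: digit_shift_top)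
  next
    case False
    then show ?thesis using v(4) that by (simp add: digit_shift_low)
  qed
  then show ?thesis using v e by (simp add: vacant_iff_digits central_shift)
qed

lemma cells_embed:
  assumes "e \<in> positions" "c \<in> cells m"
  shows "c + offset m e \<in> cells (Suc m)"
proof -
  obtain a b where c: "c = (a, b)" by fastforce
  have v: "0 \<le> a" "a < 3 ^ m" "0 \<le> b" "b < 3 ^ m"
    "\<And>k. k < m \<Longrightarrow> (a div 3 ^ k mod 3, b div 3 ^ k mod 3) \<noteq> (1, 1)"
    using assms(2) by (auto simp: cells_def c)
  have e: "0 \<le> fst e" "fst e \<le> 2" "0 \<le> snd e" "snd e \<le> 2" "(fst e mod 3, snd e mod 3) \<noteq> (1, 1)"
    using assms(1) by auto
  have "((a + 3 ^ m * fst e) div 3 ^ k mod 3, (b + 3 ^ m * snd e) div 3 ^ k mod 3) \<noteq> (1, 1)"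
    if "k < Suc m" for k
  proof (cases "k = m")
    case True
    then show ?thesis using e(5) v by (simp add: digit_shift_top)
  next
    case False
    then show ?thesis using v(5) that by (simp add: digit_shift_low)
  qed
  moreover have "0 \<le> x + 3 ^ m * z" "x + 3 ^ m * z < 3 ^ Suc m"
    if "0 \<le> x" "x < 3 ^ m" "0 \<le> z" "z \<le> 2" for x z :: int
  proof -
    have "0 \<le> 3 ^ m * z" "3 ^ m * z \<le> 3 ^ m * 2" using that by simp_all
    then show "0 \<le> x + 3 ^ m * z" "x + 3 ^ m * z < 3 ^ Suc m"
      using that unfolding power_Suc by linarith+
  qed
  ultimately show ?thesis using v e unfolding c cells_def offset_def add_Pair mem_Collect_eq by blast
qed

lemma glue_embed:
  assumes "e \<in> positions" "glue m u v"
  shows "glue (Suc m) (u + point (offset m e)) (v + point (offset m e))"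
  using assms(2)
proof cases
  case (horizontal j p q t)
  from glue.horizontal [OF vacant_embed [OF assms(1) horizontal(3)] horizontal(4,5)]
  show ?thesis by (simp add: horizontal point_def offset_def algebra_simps)
next
  case (vertical j p q t)
  from glue.vertical [OF vacant_embed [OF assms(1) vertical(3)] vertical(4,5)]
  show ?thesis by (simp add: vertical point_def offset_def algebra_simps)
qed

lemma equivclp_embed:
  assumes "e \<in> positions" "equivclp (glue m) u v"
  shows "equivclp (glue (Suc m)) (u + point (offset m e)) (v + point (offset m e))"
  using assms(2)
proof (induction rule: equivclp_induct)
  case (step y z)
  then have "equivclp (glue (Suc m)) (y + point (offset m e)) (z + point (offset m e))"
    using glue_embed [OF assms(1)] by (metis r_into_equivclp equivclp_sym)
  with step.IH show ?case by (rule equivclp_trans)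
qed simp

text \<open>Reduces equality of glued edges to matching their points, so that paths of identifications can be
  moved along the embeddings and invariants can be read off.\<close>

lemma quotient_map_image_eq_iff:
  "quotient_map m ` E = quotient_map m ` F \<longleftrightarrow>
    (\<forall>u\<in>E. \<exists>v\<in>F. equivclp (glue m) u v) \<and> (\<forall>v\<in>F. \<exists>u\<in>E. equivclp (glue m) v u)"
proof -
  have class_eq: "quotient_map m u = quotient_map m v \<longleftrightarrow> equivclp (glue m) u v" for u v
  proof
    assume "quotient_map m u = quotient_map m v"
    moreover have "v \<in> quotient_map m v" by (simp add: quotient_map_def)
    ultimately have "v \<in> quotient_map m u" by simp
    then show "equivclp (glue m) u v" by (simp add: quotient_map_def)
  next
    assume "equivclp (glue m) u v"
    then show "quotient_map m u = quotient_map m v"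
      unfolding quotient_map_def by (blast intro: equivclp_trans equivclp_sym)
  qed
  have sub: "quotient_map m ` A \<subseteq> quotient_map m ` B \<longleftrightarrow> (\<forall>u\<in>A. \<exists>v\<in>B. equivclp (glue m) u v)" for A B
    by (simp add: image_subset_iff image_iff class_eq)
  show ?thesis unfolding set_eq_subset sub ..
qed

lemma edges_shift:
  assumes "E \<in> edges c"
  shows "(\<lambda>u. u + point d) ` E \<in> edges (c + d)"
proof -
  have t: "(\<lambda>u. u + (x, y)) ` (A \<times> B) = (\<lambda>a. a + x) ` A \<times> (\<lambda>b. b + y) ` B"
    for x y :: real and A B by (auto simp: image_iff)
  obtain a b x y where c: "c = (a, b)" "d = (x, y)" by fastforce
  have d: "point d = (of_int x, of_int y)" by (simp add: c point_def)
  have i: "(\<lambda>s. s + of_int z) ` {of_int k..of_int k + 1} = {of_int (k + z)..of_int (k + z) + (1::real)}" for k z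
    by (simp add: image_add_atLeastAtMost' ac_simps)
  have s: "(\<lambda>s. s + of_int z) ` {of_int k} = {of_int (k + z) :: real}"
    "(\<lambda>s. s + of_int z) ` {of_int k + 1} = {of_int (k + z) + 1 :: real}" for k z
    by simp_all
  from assms show ?thesis
    unfolding edges_def c add_Pair prod.case d [unfolded c]
    by (elim insertE emptyE; simp only: t i s insertI1 insertI2)
qed

lemma adjV_embed:
  assumes "e \<in> positions" "adjV m c d"
  shows "adjV (Suc m) (c + offset m e) (d + offset m e)"
proof -
  obtain E F where EF: "E \<in> edges c" "F \<in> edges d" "quotient_map m ` E = quotient_map m ` F"
    using assms(2) by (auto simp: adjV_def)
  let ?s = "\<lambda>u. u + point (offset m e)"
  have "quotient_map (Suc m) ` ?s ` E = quotient_map (Suc m) ` ?s ` F"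
    using EF(3) equivclp_embed [OF assms(1)]
    unfolding quotient_map_image_eq_iff ball_simps bex_simps by meson
  moreover have "?s ` E \<in> edges (c + offset m e)" "?s ` F \<in> edges (d + offset m e)"
    using EF(1,2) by (auto intro: edges_shift)
  moreover have "c + offset m e \<noteq> d + offset m e" using assms(2) by (simp add: adjV_def)
  moreover have "c + offset m e \<in> cells (Suc m)" "d + offset m e \<in> cells (Suc m)"
    using assms by (auto simp: adjV_def intro: cells_embed)
  ultimately show ?thesis unfolding adjV_def by blast
qed

lemma adjV_sym: "adjV m c d \<Longrightarrow> adjV m d c"
  unfolding adjV_def by metis

section \<open>The diameter of the finite complexes\<close>

lemma adjV_right:
  assumes "(a, b) \<in> cells m" "(a + 1, b) \<in> cells m"
  shows "adjV m (a, b) (a + 1, b)"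
proof -
  let ?E = "{of_int a + 1 :: real} \<times> {of_int b..of_int b + 1 :: real}"
  have "?E \<in> edges (a, b)" "?E \<in> edges (a + 1, b)" by (simp_all add: edges_def)
  then show ?thesis using assms unfolding adjV_def by auto
qed

lemma adjV_up:
  assumes "(a, b) \<in> cells m" "(a, b + 1) \<in> cells m"
  shows "adjV m (a, b) (a, b + 1)"
proof -
  let ?E = "{of_int a..of_int a + 1 :: real} \<times> {of_int b + 1 :: real}"
  have "?E \<in> edges (a, b)" "?E \<in> edges (a, b + 1)" by (simp_all add: edges_def)
  then show ?thesis using assms unfolding adjV_def by auto
qed

lemma vacant_centre: "vacant (Suc m) m (3 ^ m) (3 ^ m)"
  by (auto simp: vacant_iff_digits central_def)

text \<open>The reflected edge of the bottom side with position \<open>i\<close> has position \<open>3\<^sup>m - 1 - i\<close> on the top side.\<close>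

lemma adjV_across_centre:
  assumes "(3 ^ m + i, 3 ^ m - 1) \<in> cells (Suc m)" "(2 * 3 ^ m - 1 - i, 2 * 3 ^ m) \<in> cells (Suc m)"
    and "0 \<le> i" "i < 3 ^ m"
  shows "adjV (Suc m) (3 ^ m + i, 3 ^ m - 1) (2 * 3 ^ m - 1 - i, 2 * 3 ^ m)"
proof -
  define L :: real where "L = 3 ^ m"
  define k :: real where "k = of_int i"
  have "real_of_int (i + 1) \<le> real_of_int (3 ^ m)"
    using assms(4) by (simp only: of_int_le_iff)
  then have k: "0 \<le> k" "k + 1 \<le> L" using assms(3) by (simp_all add: k_def L_def)
  let ?E = "{L + k..L + k + 1} \<times> {L}" and ?F = "{2 * L - 1 - k..2 * L - k} \<times> {2 * L}"
  have g: "glue (Suc m) (L + t, L) (2 * L - t, 2 * L)" if "0 \<le> t" "t \<le> L" for t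
    using glue.vertical [OF vacant_centre, of t m] that by (simp add: L_def algebra_simps)
  have "quotient_map (Suc m) ` ?E = quotient_map (Suc m) ` ?F"
    unfolding quotient_map_image_eq_iff
  proof (intro conjI ballI)
    fix u assume "u \<in> ?E"
    then obtain t where t: "u = (L + t, L)" "k \<le> t" "t \<le> k + 1"
      by (cases u) (auto intro!: that [of "fst u - L"])
    then have "equivclp (glue (Suc m)) u (2 * L - t, 2 * L)" using g k by (auto intro: r_into_equivclp)
    moreover have "(2 * L - t, 2 * L) \<in> ?F" using t by auto
    ultimately show "\<exists>v\<in>?F. equivclp (glue (Suc m)) u v" by blast
  next
    fix v assume "v \<in> ?F"
    then obtain t where t: "v = (2 * L - t, 2 * L)" "k \<le> t" "t \<le> k + 1"
      by (cases v) (auto intro!: that [of "2 * L - fst v"])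
    then have "equivclp (glue (Suc m)) v (L + t, L)"
      using g k by (auto intro: equivclp_sym [OF r_into_equivclp])
    moreover have "(L + t, L) \<in> ?E" using t by auto
    ultimately show "\<exists>u\<in>?E. equivclp (glue (Suc m)) v u" by blast
  qed
  moreover have "?E \<in> edges (3 ^ m + i, 3 ^ m - 1)" by (simp add: edges_def L_def k_def)
  moreover have "?F \<in> edges (2 * 3 ^ m - 1 - i, 2 * 3 ^ m)" by (simp add: edges_def L_def k_def)
  moreover have "(3 ^ m + i, 3 ^ m - 1) \<noteq> (2 * 3 ^ m - 1 - i, 2 * (3::int) ^ m)"
    using zero_less_power [of "3::int" m] by (auto simp del: zero_less_power)
  ultimately show ?thesis using assms(1,2) unfolding adjV_def by blast
qed

definition linked :: "nat \<Rightarrow> nat \<Rightarrow> cell \<Rightarrow> cell \<Rightarrow> bool" where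
  "linked m n x y \<longleftrightarrow> (\<exists>k\<le>n. (adjV m ^^ k) x y)"

lemma linked_refl: "linked m n x x"
  unfolding linked_def by (rule exI [of _ 0]) simp

lemma linked_adj: "adjV m x y \<Longrightarrow> linked m 1 x y"
  unfolding linked_def by (intro exI [of _ 1]) (auto simp: relpowp_1)

lemma linked_mono: "linked m n x y \<Longrightarrow> n \<le> n' \<Longrightarrow> linked m n' x y"
  unfolding linked_def by (meson le_trans)

lemma linked_trans: "linked m n x y \<Longrightarrow> linked m n' y z \<Longrightarrow> linked m (n + n') x z"
  unfolding linked_def by (metis add_mono relcomppI relpowp_add)

lemma linked_sym:
  assumes "linked m n x y"
  shows "linked m n y x"
proof -
  have "(adjV m ^^ k) y x" if "(adjV m ^^ k) x y" for k x y
    using that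
  proof (induction k arbitrary: y)
    case (Suc k)
    then obtain z where "(adjV m ^^ k) x z" "adjV m z y" by auto
    then show ?case using Suc.IH adjV_sym relpowp_Suc_I2 by metis
  qed simp
  then show ?thesis using assms unfolding linked_def by blast
qed

lemma relpowp_embed:
  assumes "e \<in> positions" "(adjV m ^^ k) x y"
  shows "(adjV (Suc m) ^^ k) (x + offset m e) (y + offset m e)"
  using assms(2)
proof (induction k arbitrary: y)
  case (Suc k)
  then obtain z where "(adjV m ^^ k) x z" "adjV m z y" by auto
  then show ?case by (intro relpowp_Suc_I [OF Suc.IH adjV_embed [OF assms(1)]])
qed simp

lemma linked_embed:
  "e \<in> positions \<Longrightarrow> linked m n x y \<Longrightarrow> linked (Suc m) n (x + offset m e) (y + offset m e)"
  unfolding linked_def using relpowp_embed by blast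

definition corner :: "nat \<Rightarrow> int \<Rightarrow> int \<Rightarrow> cell" where
  "corner m s t = (s * (3 ^ m - 1), t * (3 ^ m - 1))"

lemma corner_Suc: "corner (Suc m) s t = corner m s t + offset m (2 * s, 2 * t)"
  by (simp add: corner_def offset_def algebra_simps)

lemma corner_in_cells:
  assumes "s \<in> {0, 1}" "t \<in> {0, 1}"
  shows "corner m s t \<in> cells m"
proof (induction m)
  case (Suc m)
  then show ?case using assms unfolding corner_Suc by (intro cells_embed) auto
qed (auto simp: corner_def cells_def)

lemma corner_step_right:
  assumes "(i, l) \<in> positions" "(i + 1, l) \<in> positions" "t \<in> {0, 1}"
  shows "linked (Suc m) 1 (corner m 1 t + offset m (i, l)) (corner m 0 t + offset m (i + 1, l))"
proof -
  obtain a b where ab: "corner m 1 t + offset m (i, l) = (a, b)" by fastforce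
  then have ab': "corner m 0 t + offset m (i + 1, l) = (a + 1, b)"
    by (auto simp: corner_def offset_def algebra_simps)
  have "(a, b) \<in> cells (Suc m)" "(a + 1, b) \<in> cells (Suc m)"
    using assms by (auto simp only: ab [symmetric] ab' [symmetric] insert_iff intro!: cells_embed corner_in_cells)
  then show ?thesis unfolding ab ab' by (intro linked_adj adjV_right)
qed

lemma corner_step_up:
  assumes "(i, l) \<in> positions" "(i, l + 1) \<in> positions" "s \<in> {0, 1}"
  shows "linked (Suc m) 1 (corner m s 1 + offset m (i, l)) (corner m s 0 + offset m (i, l + 1))"
proof -
  obtain a b where ab: "corner m s 1 + offset m (i, l) = (a, b)" by fastforce
  then have ab': "corner m s 0 + offset m (i, l + 1) = (a, b + 1)"
    by (auto simp: corner_def offset_def algebra_simps)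
  have "(a, b) \<in> cells (Suc m)" "(a, b + 1) \<in> cells (Suc m)"
    using assms by (auto simp only: ab [symmetric] ab' [symmetric] insert_iff intro!: cells_embed corner_in_cells)
  then show ?thesis unfolding ab ab' by (intro linked_adj adjV_up)
qed

text \<open>At \<open>s \<in> {0, 1}\<close> the reflection exchanges the two ends, so one step leads from next to one corner of
  the central vacant square to next to the opposite corner.\<close>

lemma corner_step_across:
  assumes "s \<in> {0, 1}"
  shows "linked (Suc m) 1 (corner m s 1 + offset m (1, 0)) (corner m (1 - s) 0 + offset m (1, 2))"
proof -
  define i where "i = s * (3 ^ m - 1)"
  have c: "corner m s 1 + offset m (1, 0) = (3 ^ m + i, 3 ^ m - 1)"
    "corner m (1 - s) 0 + offset m (1, 2) = (2 * 3 ^ m - 1 - i, 2 * 3 ^ m)"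
    by (simp_all add: corner_def offset_def i_def algebra_simps)
  have "corner m s 1 + offset m (1, 0) \<in> cells (Suc m)" "corner m (1 - s) 0 + offset m (1, 2) \<in> cells (Suc m)"
    using assms by (intro cells_embed corner_in_cells; auto)+
  moreover have "0 \<le> i" "i < 3 ^ m" using assms by (auto simp: i_def)
  ultimately show ?thesis unfolding c by (intro linked_adj adjV_across_centre)
qed

text \<open>Cross the copy of \<open>V\<^sub>m\<close> at one end, pass through the central vacant square in three steps, and cross
  the copy at the other end.  The length \<open>D\<^sub>m\<close> satisfies \<open>D\<^sub>m\<^sub>+\<^sub>1 = 2 D\<^sub>m + 3\<close>: this factor \<open>2\<close>,
  in place of \<open>3\<close>, is where the exponent \<open>3 = log\<^sub>2 8\<close> comes from.\<close>

lemma corner_diagonal: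
  assumes "s \<in> {0, 1}"
  shows "linked m (3 * (2 ^ m - 1)) (corner m s 0) (corner m (1 - s) 1)"
proof (induction m)
  case (Suc m)
  have one: "1 \<le> (2::nat) ^ m" by simp
  let ?n = "3 * (2 ^ m - 1) :: nat"
  have 1: "linked (Suc m) ?n (corner (Suc m) s 0) (corner m (1 - s) 1 + offset m (2 * s, 0))"
    using linked_embed [OF _ Suc, of "(2 * s, 0)"] assms unfolding corner_Suc by auto
  have 2: "linked (Suc m) 1 (corner m (1 - s) 1 + offset m (2 * s, 0)) (corner m s 1 + offset m (1, 0))"
    using assms corner_step_right [of 0 0 1 m] linked_sym [OF corner_step_right [of 1 0 1 m]] by auto
  have 3: "linked (Suc m) 1 (corner m s 1 + offset m (1, 0)) (corner m (1 - s) 0 + offset m (1, 2))"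
    by (rule corner_step_across [OF assms])
  have 4: "linked (Suc m) 1 (corner m (1 - s) 0 + offset m (1, 2)) (corner m s 0 + offset m (2 * (1 - s), 2))"
    using assms corner_step_right [of 1 2 0 m] linked_sym [OF corner_step_right [of 0 2 0 m]] by auto
  have 5: "linked (Suc m) ?n (corner m s 0 + offset m (2 * (1 - s), 2)) (corner (Suc m) (1 - s) 1)"
    using linked_embed [OF _ Suc, of "(2 * (1 - s), 2)"] assms unfolding corner_Suc by auto
  have "linked (Suc m) (?n + 1 + 1 + 1 + ?n) (corner (Suc m) s 0) (corner (Suc m) (1 - s) 1)"
    by (intro linked_trans [OF linked_trans [OF linked_trans [OF linked_trans [OF 1 2] 3] 4] 5])
  moreover have "?n + 1 + 1 + 1 + ?n = 3 * (2 ^ Suc m - 1)"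
    using one unfolding power_Suc by linarith
  ultimately show ?case by simp
qed (use assms in \<open>simp add: corner_def linked_refl\<close>)

text \<open>Run diagonally to a corner of the central vacant square, along one side of the middle copy, and
  diagonally back.  The middle copy is entered on its inner side, whence \<open>1 - t\<close>; since only one side
  of a copy is used, the sides are as short as the diagonals up to a factor.\<close>

lemma corner_side_horizontal:
  assumes "t \<in> {0, 1}"
  shows "linked m (6 * 2 ^ m) (corner m 0 t) (corner m 1 t)"
  using assms
proof (induction m arbitrary: t)
  case (Suc m)
  have one: "1 \<le> (2::nat) ^ m" by simp
  let ?n = "3 * (2 ^ m - 1) :: nat"
  have diag: "linked m ?n (corner m 0 s) (corner m 1 (1 - s))" if "s \<in> {0, 1}" for s
    using that corner_diagonal [of 0 m] linked_sym [OF corner_diagonal [of 1 m]] by auto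
  have t: "1 - t \<in> {0, 1}" "2 * t \<in> {0, 2}" using Suc.prems by auto
  have 1: "linked (Suc m) ?n (corner (Suc m) 0 t) (corner m 1 (1 - t) + offset m (0, 2 * t))"
    using linked_embed [OF _ diag [of t], of "(0, 2 * t)"] Suc.prems t unfolding corner_Suc by auto
  have 2: "linked (Suc m) 1 (corner m 1 (1 - t) + offset m (0, 2 * t)) (corner m 0 (1 - t) + offset m (1, 2 * t))"
    using corner_step_right [of 0 "2 * t" "1 - t" m] t by auto
  have 3: "linked (Suc m) (6 * 2 ^ m) (corner m 0 (1 - t) + offset m (1, 2 * t)) (corner m 1 (1 - t) + offset m (1, 2 * t))"
    using linked_embed [OF _ Suc.IH [OF t(1)], of "(1, 2 * t)"] t by auto
  have 4: "linked (Suc m) 1 (corner m 1 (1 - t) + offset m (1, 2 * t)) (corner m 0 (1 - t) + offset m (2, 2 * t))"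
    using corner_step_right [of 1 "2 * t" "1 - t" m] t by auto
  have 5: "linked (Suc m) ?n (corner m 0 (1 - t) + offset m (2, 2 * t)) (corner (Suc m) 1 t)"
    using linked_embed [OF _ diag [OF t(1)], of "(2, 2 * t)"] t unfolding corner_Suc by auto
  have "linked (Suc m) (?n + 1 + 6 * 2 ^ m + 1 + ?n) (corner (Suc m) 0 t) (corner (Suc m) 1 t)"
    by (intro linked_trans [OF linked_trans [OF linked_trans [OF linked_trans [OF 1 2] 3] 4] 5])
  then show ?case 
    by (rule linked_mono) (use one in \<open>unfold power_Suc, linarith\<close>)
qed (simp add: corner_def linked_refl)

lemma corner_side_vertical:
  assumes "s \<in> {0, 1}"
  shows "linked m (6 * 2 ^ m) (corner m s 0) (corner m s 1)"
  using assms
proof (induction m arbitrary: s)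
  case (Suc m)
  have one: "1 \<le> (2::nat) ^ m" by simp
  let ?n = "3 * (2 ^ m - 1) :: nat"
  have s: "1 - s \<in> {0, 1}" "2 * s \<in> {0, 2}" using Suc.prems by auto
  have 1: "linked (Suc m) ?n (corner (Suc m) s 0) (corner m (1 - s) 1 + offset m (2 * s, 0))"
    using linked_embed [OF _ corner_diagonal [OF Suc.prems], of "(2 * s, 0)"] s unfolding corner_Suc by auto
  have 2: "linked (Suc m) 1 (corner m (1 - s) 1 + offset m (2 * s, 0)) (corner m (1 - s) 0 + offset m (2 * s, 1))"
    using corner_step_up [of "2 * s" 0 "1 - s" m] s by auto
  have 3: "linked (Suc m) (6 * 2 ^ m) (corner m (1 - s) 0 + offset m (2 * s, 1)) (corner m (1 - s) 1 + offset m (2 * s, 1))"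
    using linked_embed [OF _ Suc.IH [OF s(1)], of "(2 * s, 1)"] s by auto
  have 4: "linked (Suc m) 1 (corner m (1 - s) 1 + offset m (2 * s, 1)) (corner m (1 - s) 0 + offset m (2 * s, 2))"
    using corner_step_up [of "2 * s" 1 "1 - s" m] s by auto
  have 5: "linked (Suc m) ?n (corner m (1 - s) 0 + offset m (2 * s, 2)) (corner (Suc m) s 1)"
    using linked_embed [OF _ corner_diagonal [OF s(1)], of "(2 * s, 2)"] s unfolding corner_Suc by auto
  have "linked (Suc m) (?n + 1 + 6 * 2 ^ m + 1 + ?n) (corner (Suc m) s 0) (corner (Suc m) s 1)"
    by (intro linked_trans [OF linked_trans [OF linked_trans [OF linked_trans [OF 1 2] 3] 4] 5])
  then show ?case 
    by (rule linked_mono) (use one in \<open>unfold power_Suc, linarith\<close>)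
qed (simp add: corner_def linked_refl)

lemma offset_step_right:
  assumes "(i, l) \<in> positions" "(i + 1, l) \<in> positions"
  shows "linked (Suc m) (6 * 2 ^ m + 1) (offset m (i + 1, l)) (offset m (i, l))"
  using linked_sym [OF linked_trans [OF linked_embed [OF assms(1) corner_side_horizontal [of 0 m]]
      corner_step_right [OF assms, of 0 m]]]
  by (simp add: corner_def flip: zero_prod_def)

lemma offset_step_up:
  assumes "(i, l) \<in> positions" "(i, l + 1) \<in> positions"
  shows "linked (Suc m) (6 * 2 ^ m + 1) (offset m (i, l + 1)) (offset m (i, l))"
  using linked_sym [OF linked_trans [OF linked_embed [OF assms(1) corner_side_vertical [of 0 m]]
      corner_step_up [OF assms, of 0 m]]]
  by (simp add: corner_def flip: zero_prod_def)

text \<open>The eight copies form a ring, so four moves along sides suffice.\<close>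

lemma offset_to_origin:
  assumes "e \<in> positions"
  shows "linked (Suc m) (4 * (6 * 2 ^ m + 1)) (offset m e) 0"
proof -
  let ?k = "6 * 2 ^ m + 1"
  have 0: "offset m (0, 0) = 0" by (simp add: offset_def zero_prod_def)
  have 1: "linked (Suc m) ?k (offset m (1, 0)) 0" "linked (Suc m) ?k (offset m (0, 1)) 0"
    using offset_step_right [of 0 0 m] offset_step_up [of 0 0 m] by (auto simp: 0)
  have 2: "linked (Suc m) (?k + ?k) (offset m (2, 0)) 0" "linked (Suc m) (?k + ?k) (offset m (0, 2)) 0"
    using linked_trans [OF offset_step_right [of 1 0 m] 1(1)] linked_trans [OF offset_step_up [of 0 1 m] 1(2)]
    by auto
  have 3: "linked (Suc m) (?k + (?k + ?k)) (offset m (2, 1)) 0" "linked (Suc m) (?k + (?k + ?k)) (offset m (1, 2)) 0"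
    using linked_trans [OF offset_step_up [of 2 0 m] 2(1)] linked_trans [OF offset_step_right [of 0 2 m] 2(2)]
    by auto
  have 4: "linked (Suc m) (?k + (?k + (?k + ?k))) (offset m (2, 2)) 0"
    using linked_trans [OF offset_step_up [of 2 1 m] 3(1)] by auto
  have e: "e = (0, 0) \<or> e = (1, 0) \<or> e = (0, 1) \<or> e = (2, 0) \<or> e = (0, 2) \<or> e = (2, 1) \<or> e = (1, 2) \<or> e = (2, 2)"
    using assms by auto
  show ?thesis
    using e
    by (elim disjE) (use 0 linked_mono [OF 1(1)] linked_mono [OF 1(2)] linked_mono [OF 2(1)]
      linked_mono [OF 2(2)] linked_mono [OF 3(1)] linked_mono [OF 3(2)] linked_mono [OF 4] linked_refl in auto)
qed

lemma cells_SucE: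
  assumes "c \<in> cells (Suc m)"
  obtains d e where "c = d + offset m e" "d \<in> cells m" "e \<in> positions"
proof -
  obtain a b where c: "c = (a, b)" by fastforce
  have v: "0 \<le> a" "a < 3 * 3 ^ m" "0 \<le> b" "b < 3 * 3 ^ m"
    "\<And>k. k < Suc m \<Longrightarrow> (a div 3 ^ k mod 3, b div 3 ^ k mod 3) \<noteq> (1, 1)"
    using assms by (auto simp: cells_def c)
  let ?d = "(a mod 3 ^ m, b mod 3 ^ m)" and ?e = "(a div 3 ^ m, b div 3 ^ m)"
  have top: "x div 3 ^ m \<in> {0, 1, 2}" if "0 \<le> x" "x < 3 * 3 ^ m" for x :: int
  proof -
    have "0 \<le> x div 3 ^ m" using that by (simp add: pos_imp_zdiv_nonneg_iff)
    moreover have "x div 3 ^ m < 3"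
    proof (rule ccontr)
      assume "\<not> x div 3 ^ m < 3"
      then have "3 ^ m * 3 \<le> 3 ^ m * (x div 3 ^ m)" by simp
      moreover have "0 \<le> x mod 3 ^ m" by simp
      ultimately show False using that mult_div_mod_eq [of "3 ^ m" x] by linarith
    qed
    ultimately have "x div 3 ^ m = 0 \<or> x div 3 ^ m = 1 \<or> x div 3 ^ m = 2" by linarith
    then show ?thesis by auto
  qed
  have "?d \<in> cells m" using v(5) by (auto simp: cells_def digit_mod)
  moreover have "?e \<in> positions" using top [OF v(1,2)] top [OF v(3,4)] v(5) [of m] by auto
  moreover have "c = ?d + offset m ?e" by (simp add: c offset_def)
  ultimately show ?thesis by (rule that [rotated])
qed

lemma cell_to_origin:
  assumes "c \<in> cells m"
  shows "linked m (28 * 2 ^ m) c 0"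
  using assms
proof (induction m arbitrary: c)
  case 0
  then have "c = 0" by (auto simp: cells_def zero_prod_def)
  then show ?case by (simp add: linked_refl)
next
  case (Suc m)
  obtain d e where d: "c = d + offset m e" "d \<in> cells m" "e \<in> positions"
    using cells_SucE [OF Suc.prems] .
  have "linked (Suc m) (28 * 2 ^ m) c (offset m e)"
    using linked_embed [OF d(3) Suc.IH [OF d(2)]] d(1) by simp
  from linked_trans [OF this offset_to_origin [OF d(3)]] show ?case
    by (rule linked_mono) simp
qed

lemma diameter_le:
  assumes "c \<in> cells m" "d \<in> cells m"
  shows "linked m (56 * 2 ^ m) c d"
  using linked_mono [OF linked_trans [OF cell_to_origin [OF assms(1)] linked_sym [OF cell_to_origin [OF assms(2)]]]]
  by simp

section \<open>The Cantor staircase\<close>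

text \<open>An even integer version of the Cantor function: it rises from \<open>0\<close> at \<open>0\<close> to \<open>2\<^sup>m\<close> at \<open>3\<^sup>m\<close>.  The
  recursion refines at the finest scale: each unit interval is split in three, the middle part is
  flat, and each outer part takes over the whole former increment, with the values doubled.\<close>

primrec cantor :: "nat \<Rightarrow> int \<Rightarrow> int" where
  "cantor 0 t = (if t = 0 then 0 else 1)"
| "cantor (Suc m) t =
    (if t mod 3 = 0 then 2 * cantor m (t div 3) else cantor m (t div 3) + cantor m (t div 3 + 1))"

lemma cantor_thirds [simp]:
  "cantor (Suc m) (3 * a) = 2 * cantor m a"
  "cantor (Suc m) (3 * a + 1) = cantor m a + cantor m (a + 1)"
  "cantor (Suc m) (3 * a + 2) = cantor m a + cantor m (a + 1)"
proof -
  have "(3 * a + 1) div 3 = a" "(3 * a + 2) div 3 = a" "(3 * a + 1) mod 3 = 1" "(3 * a + 2) mod 3 = 2"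
    by presburger+
  then show "cantor (Suc m) (3 * a) = 2 * cantor m a"
    "cantor (Suc m) (3 * a + 1) = cantor m a + cantor m (a + 1)"
    "cantor (Suc m) (3 * a + 2) = cantor m a + cantor m (a + 1)"
    by simp_all
qed

declare cantor.simps(2) [simp del]

lemma thirds_cases:
  fixes t :: int
  obtains a where "t = 3 * a" | a where "t = 3 * a + 1" | a where "t = 3 * a + 2"
proof -
  have "t = 3 * (t div 3) \<or> t = 3 * (t div 3) + 1 \<or> t = 3 * (t div 3) + 2" by presburger
  then show ?thesis using that by blast
qed

lemma cantor_le: "cantor m t \<le> 2 ^ m"
proof (induction m arbitrary: t)
  case (Suc m)
  show ?case
  proof (cases t rule: thirds_cases)
    case (1 a)
    then show ?thesis using Suc [of a] by simp
  next
    case (2 a)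
    then show ?thesis using Suc [of a] Suc [of "a + 1"] by simp
  next
    case (3 a)
    then show ?thesis using Suc [of a] Suc [of "a + 1"] by simp
  qed
qed simp

lemma cantor_minus: "cantor m (- t) = cantor m t"
proof (induction m arbitrary: t)
  case (Suc m)
  show ?case
  proof (cases t rule: thirds_cases)
    case (1 a)
    then show ?thesis using Suc [of a] cantor_thirds(1) [of m "- a"] by simp
  next
    case (2 a)
    have "- t = 3 * (- (a + 1)) + 2" using 2 by simp
    then show ?thesis using Suc [of a] Suc [of "a + 1"] 2 by (simp only: cantor_thirds) simp
  next
    case (3 a)
    have "- t = 3 * (- (a + 1)) + 1" using 3 by simp
    then show ?thesis using Suc [of a] Suc [of "a + 1"] 3 by (simp only: cantor_thirds) simp
  qed
qed simp

lemma cantor_step: "\<bar>cantor m (t + 1) - cantor m t\<bar> \<le> 1"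
proof (induction m arbitrary: t)
  case (Suc m)
  show ?case
  proof (cases t rule: thirds_cases)
    case (1 a)
    then show ?thesis using Suc [of a] by simp
  next
    case (2 a)
    have e: "t + 1 = 3 * a + 2" using 2 by simp
    show ?thesis unfolding e unfolding 2 cantor_thirds by simp
  next
    case (3 a)
    have "t + 1 = 3 * (a + 1)" using 3 by simp
    then show ?thesis using Suc [of a] 3 by (simp only: cantor_thirds)
  qed
qed simp

lemma cantor_far:
  assumes "3 ^ m \<le> \<bar>t\<bar>"
  shows "cantor m t = 2 ^ m"
proof -
  have pos: "cantor m t = 2 ^ m" if "3 ^ m \<le> t" for t
    using that
  proof (induction m arbitrary: t)
    case (Suc m)
    show ?case
    proof (cases t rule: thirds_cases)
      case (1 a)
      then show ?thesis using Suc.IH [of a] Suc.prems by simp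
    next
      case (2 a)
      then have "3 ^ m \<le> a" using Suc.prems by simp
      then show ?thesis using Suc.IH [of a] Suc.IH [of "a + 1"] 2 by simp
    next
      case (3 a)
      then have "3 ^ m \<le> a" using Suc.prems by simp
      then show ?thesis using Suc.IH [of a] Suc.IH [of "a + 1"] 3 by simp
    qed
  qed simp
  show ?thesis
  proof (cases "0 \<le> t")
    case True
    then show ?thesis using pos assms by simp
  next
    case False
    then show ?thesis using pos [of "- t"] assms by (simp add: cantor_minus)
  qed
qed

text \<open>The graph of the staircase over \<open>[0, 3\<^sup>m]\<close> is symmetric under the point reflection in its midpoint.\<close>

lemma cantor_complement:
  "0 \<le> t \<Longrightarrow> t \<le> 3 ^ m \<Longrightarrow> cantor m t + cantor m (3 ^ m - t) = 2 ^ m"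
proof (induction m arbitrary: t)
  case (Suc m)
  show ?case
  proof (cases t rule: thirds_cases)
    case (1 a)
    have "3 ^ Suc m - t = 3 * (3 ^ m - a)" using 1 by simp
    then show ?thesis using Suc.IH [of a] Suc.prems 1 by (simp only: cantor_thirds) simp
  next
    case (2 a)
    have e: "3 ^ Suc m - t = 3 * (3 ^ m - (a + 1)) + 2" using 2 by simp
    have "0 \<le> a" "a + 1 \<le> 3 ^ m" using 2 Suc.prems by auto
    then show ?thesis
      using Suc.IH [of a] Suc.IH [of "a + 1"] unfolding e unfolding 2 cantor_thirds by (simp add: algebra_simps)
  next
    case (3 a)
    have e: "3 ^ Suc m - t = 3 * (3 ^ m - (a + 1)) + 1" using 3 by simp
    have "0 \<le> a" "a + 1 \<le> 3 ^ m" using 3 Suc.prems by auto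
    then show ?thesis
      using Suc.IH [of a] Suc.IH [of "a + 1"] unfolding e unfolding 3 cantor_thirds by (simp add: algebra_simps)
  qed
qed auto

text \<open>Middle thirds of length \<open>3\<^sup>j\<close> with \<open>j < m\<close> are the flat parts of the staircase.\<close>

lemma cantor_const:
  assumes "j < m" "3 ^ (j + 1) dvd p - 3 ^ j" "0 \<le> t" "t \<le> 3 ^ j"
  shows "cantor m (p + t) = cantor m p"
  using assms
proof (induction j arbitrary: m p t)
  case 0
  then obtain k where k: "p = 3 * k + 1" by (auto simp: dvd_def diff_eq_eq)
  obtain n where n: "m = Suc n" using 0 by (cases m) auto
  have "t = 0 \<or> t = 1" using 0 by auto
  then show ?case
  proof
    assume "t = 1"
    then have e: "p + t = 3 * k + 2" using k by simp
    show ?thesis unfolding e unfolding n k cantor_thirds ..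
  qed simp
next
  case (Suc j)
  obtain n where n: "m = Suc n" using Suc by (cases m) auto
  obtain k where k: "p = 3 * (3 ^ (j + 1) * k + 3 ^ j)"
    using Suc.prems(2) by (auto simp: dvd_def diff_eq_eq)
  define r where "r = 3 ^ (j + 1) * k + 3 ^ j"
  have r: "cantor n (r + b) = cantor n r" if "0 \<le> b" "b \<le> 3 ^ j" for b
    using Suc.IH [of n r b] Suc.prems(1) that by (simp add: n r_def)
  have p: "p = 3 * r" using k by (simp add: r_def)
  show ?case
  proof (cases t rule: thirds_cases)
    case (1 a)
    have e: "p + t = 3 * (r + a)" using 1 p by simp
    have ra: "cantor n (r + a) = cantor n r" using 1 Suc.prems(3,4) by (intro r) auto
    show ?thesis unfolding e unfolding n p cantor_thirds ra ..
  next
    case (2 a)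
    have e: "p + t = 3 * (r + a) + 1" using 2 p by simp
    have "0 \<le> a" "a + 1 \<le> 3 ^ j" using 2 Suc.prems(3,4) by auto
    then show ?thesis using r [of a] r [of "a + 1"] unfolding e unfolding n p cantor_thirds by (simp add: add.assoc)
  next
    case (3 a)
    have e: "p + t = 3 * (r + a) + 2" using 3 p by simp
    have "0 \<le> a" "a + 1 \<le> 3 ^ j" using 3 Suc.prems(3,4) by auto
    then show ?thesis using r [of a] r [of "a + 1"] unfolding e unfolding n p cantor_thirds by (simp add: add.assoc)
  qed
qed

section \<open>Identified lattice points\<close>

definition in_hole :: "nat \<Rightarrow> int \<Rightarrow> int \<Rightarrow> int \<times> int \<Rightarrow> bool" where
  "in_hole j p q u \<longleftrightarrow> p \<le> fst u \<and> fst u \<le> p + 3 ^ j \<and> q \<le> snd u \<and> snd u \<le> q + 3 ^ j"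

definition antipode :: "nat \<Rightarrow> int \<Rightarrow> int \<Rightarrow> int \<times> int \<Rightarrow> int \<times> int" where
  "antipode j p q u = (2 * p + 3 ^ j - fst u, 2 * q + 3 ^ j - snd u)"

lemma antipode_antipode [simp]: "antipode j p q (antipode j p q u) = u"
  by (simp add: antipode_def)

lemma in_hole_antipode [simp]: "in_hole j p q (antipode j p q u) = in_hole j p q u"
  by (auto simp: in_hole_def antipode_def)

text \<open>Read on lattice points, the two kinds of identification are the same reflection.\<close>

lemma glue_points:
  assumes "glue M u v" "point c = u \<or> point c = v"
  obtains j p q where "vacant M j p q" "in_hole j p q c"
    "point c = u \<Longrightarrow> v = point (antipode j p q c)"
    "point c = v \<Longrightarrow> u = point (antipode j p q c)"
proof -
  have le: "a \<le> b + 3 ^ j" if "real_of_int a \<le> of_int b + 3 ^ j" for a b j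
  proof -
    have "real_of_int a \<le> real_of_int (b + 3 ^ j)" using that by simp
    then show ?thesis by (simp only: of_int_le_iff)
  qed
  have eq: "a = b + 3 ^ j" if "real_of_int a = of_int b + 3 ^ j" for a b j
  proof -
    have "real_of_int a = real_of_int (b + 3 ^ j)" using that by simp
    then show ?thesis by (simp only: of_int_eq_iff)
  qed
  from assms(1) show ?thesis
  proof cases
    case (horizontal j p q t)
    have x: "fst c = p \<or> fst c = p + 3 ^ j"
      using assms(2) horizontal(1,2) by (auto simp: point_def intro: eq)
    have y: "q \<le> snd c" "snd c \<le> q + 3 ^ j"
      using assms(2) horizontal by (auto simp: point_def intro!: le)
    have "in_hole j p q c" using x y by (auto simp: in_hole_def)
    then show ?thesis using that [OF horizontal(3)] horizontal(1,2) by (auto simp: point_def antipode_def)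
  next
    case (vertical j p q t)
    have y: "snd c = q \<or> snd c = q + 3 ^ j"
      using assms(2) vertical(1,2) by (auto simp: point_def intro: eq)
    have x: "p \<le> fst c" "fst c \<le> p + 3 ^ j"
      using assms(2) vertical by (auto simp: point_def intro!: le)
    have "in_hole j p q c" using x y by (auto simp: in_hole_def)
    then show ?thesis using that [OF vertical(3)] vertical(1,2) by (auto simp: point_def antipode_def)
  qed
qed

text \<open>Distinct closed vacant squares are disjoint: a smaller one lies in the interior of its block, so a
  larger one that meets it contains the block, against vacancy; two of equal size have corners that
  agree modulo \<open>3\<^sup>j\<^sup>+\<^sup>1\<close> and differ by at most \<open>3\<^sup>j\<close>.\<close>

lemma hole_unique:
  assumes "vacant M j p q" "vacant M k p' q'" "in_hole j p q u" "in_hole k p' q' u"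
  shows "j = k \<and> p = p' \<and> q = q'"
proof -
  have not_less: False
    if v: "vacant M j p q" "vacant M k p' q'" "in_hole j p q u" "in_hole k p' q' u" and jk: "j < k"
    for j k p p' q q'
  proof -
    have c: "central M j p" "central M j q" "central M k p'" "central M k q'"
      using v(1,2) by (auto simp: vacant_iff_digits)
    have d: "3 ^ k dvd r" if "central M k r" for r
    proof -
      have "(3::int) ^ k dvd 3 ^ (k + 1)" by (intro le_imp_power_dvd) simp
      moreover have "3 ^ (k + 1) dvd r - 3 ^ k" using that by (simp add: central_def)
      ultimately have "3 ^ k dvd r - 3 ^ k" by (rule dvd_trans)
      then have "3 ^ k dvd (r - 3 ^ k) + 3 ^ k" by (intro dvd_add) simp_all
      then show ?thesis by simp
    qed
    have "p' \<le> p - 3 ^ j" "p + 2 * 3 ^ j \<le> p' + 3 ^ k"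
      using central_inside [OF c(1) jk d [OF c(3)]] v(3,4) by (auto simp: in_hole_def)
    moreover have "q' \<le> q - 3 ^ j" "q + 2 * 3 ^ j \<le> q' + 3 ^ k"
      using central_inside [OF c(2) jk d [OF c(4)]] v(3,4) by (auto simp: in_hole_def)
    ultimately show False using v(1,2) jk by (subst (asm) vacant_unfold) blast
  qed
  have jk: "j = k"
    using not_less [OF assms] not_less [OF assms(2,1,4,3)] by (cases rule: linorder_cases [of j k]) simp_all
  have "r = r'" if "central M j r" "central M j r'" "r \<le> x" "x \<le> r + 3 ^ j" "r' \<le> x" "x \<le> r' + 3 ^ j"
    for r r' x
  proof -
    have "3 ^ (j + 1) dvd r - 3 ^ j" "3 ^ (j + 1) dvd r' - 3 ^ j"
      using that(1,2) by (simp_all add: central_def)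
    then have "3 ^ (j + 1) dvd (r - 3 ^ j) - (r' - 3 ^ j)" by (rule dvd_diff)
    moreover have "\<bar>(r - 3 ^ j) - (r' - 3 ^ j)\<bar> < 3 ^ (j + 1)"
    proof -
      have "\<bar>(r - 3 ^ j) - (r' - 3 ^ j)\<bar> \<le> 3 ^ j" using that(3-6) by linarith
      also have "(3::int) ^ j < 3 ^ (j + 1)" by simp
      finally show ?thesis .
    qed
    ultimately have "(r - 3 ^ j) - (r' - 3 ^ j) = 0"
      using dvd_imp_le_int [of "(r - 3 ^ j) - (r' - 3 ^ j)" "3 ^ (j + 1)"]
      by (cases "(r - 3 ^ j) - (r' - 3 ^ j) = 0") auto
    then show ?thesis by simp
  qed
  moreover have "central M j p" "central M j q" "central M j p'" "central M j q'"
    using assms(1,2) by (auto simp: vacant_iff_digits jk)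
  ultimately show ?thesis using assms(3,4) by (auto simp: in_hole_def jk)
qed

definition on_grid :: "nat \<Rightarrow> int \<times> int \<Rightarrow> bool" where
  "on_grid m z \<longleftrightarrow> 3 ^ m dvd fst z \<and> 3 ^ m dvd snd z"

text \<open>The reflection applies to every lattice point of the closed vacant square; on the boundary the
  reflected points are the identified ones.\<close>

definition orbit :: "nat \<Rightarrow> int \<times> int \<Rightarrow> (int \<times> int) set" where
  "orbit M z = insert z {antipode j p q z | j p q. vacant M j p q \<and> in_hole j p q z}"

lemma orbit_small: "finite (orbit M z) \<and> card (orbit M z) \<le> 2"
proof -
  let ?A = "{antipode j p q z | j p q. vacant M j p q \<and> in_hole j p q z}"
  have "\<exists>w. ?A \<subseteq> {w}"
  proof (cases "?A = {}")
    case True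
    then show ?thesis by (simp only: empty_subsetI) simp
  next
    case False
    then obtain j p q where h: "vacant M j p q" "in_hole j p q z" by blast
    have "?A \<subseteq> {antipode j p q z}"
    proof
      fix w assume "w \<in> ?A"
      then obtain k p' q' where k: "vacant M k p' q'" "in_hole k p' q' z" "w = antipode k p' q' z" by blast
      then show "w \<in> {antipode j p q z}" using hole_unique [OF k(1) h(1) k(2) h(2)] by simp
    qed
    then show ?thesis by blast
  qed
  then obtain w where w: "?A \<subseteq> {w}" by (elim exE)
  have "orbit M z \<subseteq> {z, w}" unfolding orbit_def by (rule insert_mono [OF w])
  moreover have "finite {z, w}" "card {z, w} \<le> 2" by (auto simp: card_insert_if)
  ultimately show ?thesis by (meson card_mono finite_subset le_trans)
qed

lemma orbit_closed:
  assumes "w \<in> orbit M z" "vacant M j p q" "in_hole j p q w"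
  shows "antipode j p q w \<in> orbit M z"
proof (cases "w = z")
  case True
  then show ?thesis using assms(2,3) by (auto simp: orbit_def)
next
  case False
  then obtain k p' q' where h: "vacant M k p' q'" "in_hole k p' q' z" "w = antipode k p' q' z"
    using assms(1) by (auto simp: orbit_def)
  then have "j = k \<and> p = p' \<and> q = q'" using hole_unique [OF assms(2) h(1) assms(3)] by simp
  then show ?thesis using h by (simp add: orbit_def)
qed

text \<open>A vacant square smaller than the grid lies strictly between grid lines, and a larger one has its
  sides on grid lines.\<close>

lemma hole_with_grid_point:
  assumes "central M j p" "3 ^ m dvd z" "p \<le> z" "z \<le> p + 3 ^ j"
  shows "m \<le> j \<and> 3 ^ m dvd p"
proof -
  have "m \<le> j"
  proof (rule ccontr)
    assume "\<not> m \<le> j"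
    then have "(3::int) ^ (j + 1) dvd 3 ^ m" by (intro le_imp_power_dvd) simp
    then have "3 ^ (j + 1) dvd z" using assms(2) by (rule dvd_trans)
    moreover have "3 ^ (j + 1) dvd p - 3 ^ j" using assms(1) by (simp add: central_def)
    ultimately have "3 ^ (j + 1) dvd z - (p - 3 ^ j)" by (rule dvd_diff)
    moreover have "0 < z - (p - 3 ^ j)" "z - (p - 3 ^ j) < 3 ^ (j + 1)"
    proof -
      have "(0::int) < 3 ^ j" by simp
      then show "0 < z - (p - 3 ^ j)" "z - (p - 3 ^ j) < 3 ^ (j + 1)"
        using assms(3,4) unfolding power_add power_one_right by linarith+
    qed
    ultimately show False using zdvd_not_zless by blast
  qed
  have "(3::int) ^ m dvd 3 ^ (j + 1)" "(3::int) ^ m dvd 3 ^ j"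
    using \<open>m \<le> j\<close> by (intro le_imp_power_dvd; simp)+
  moreover have "3 ^ (j + 1) dvd p - 3 ^ j" using assms(1) by (simp add: central_def)
  ultimately have "3 ^ m dvd (p - 3 ^ j) + 3 ^ j" by (intro dvd_add) (rule dvd_trans)
  then show ?thesis using \<open>m \<le> j\<close> by simp
qed

lemma orbit_on_grid:
  assumes "on_grid m z" "w \<in> orbit M z"
  shows "on_grid m w"
proof (cases "w = z")
  case False
  then obtain j p q where h: "vacant M j p q" "in_hole j p q z" "w = antipode j p q z"
    using assms(2) by (auto simp: orbit_def)
  have c: "central M j p" "central M j q" using h(1) by (auto simp: vacant_iff_digits)
  have "m \<le> j \<and> 3 ^ m dvd p" "m \<le> j \<and> 3 ^ m dvd q"
    using hole_with_grid_point [OF c(1), of m "fst z"] hole_with_grid_point [OF c(2), of m "snd z"] h(2) assms(1)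
    by (auto simp: in_hole_def on_grid_def)
  moreover from this have "(3::int) ^ m dvd 3 ^ j" by (intro le_imp_power_dvd) simp
  ultimately show ?thesis
    using assms(1) by (auto simp: h(3) antipode_def on_grid_def intro!: dvd_diff dvd_add)
qed (use assms in simp)

section \<open>A potential on the glued complex\<close>

definition spread :: "nat \<Rightarrow> int \<times> int \<Rightarrow> int \<times> int \<Rightarrow> int" where
  "spread m z u = max (cantor m (fst u - fst z)) (cantor m (snd u - snd z))"

definition potential :: "nat \<Rightarrow> (int \<times> int) set \<Rightarrow> int \<times> int \<Rightarrow> int" where
  "potential m Z u = Min ((\<lambda>z. spread m z u) ` Z)"

lemma spread_le: "spread m z u \<le> 2 ^ m"
  by (simp add: spread_def cantor_le)

lemma spread_antipode:
  "spread m (antipode j p q z) (antipode j p q u) = spread m z u"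
proof -
  have "cantor m (c - x - (c - y)) = cantor m (x - y)" for c x y
    using cantor_minus [of m "x - y"] by simp
  then show ?thesis by (simp add: spread_def antipode_def)
qed

lemma spread_small_hole:
  assumes "central M j p" "central M j q" "j < m" "on_grid m z" "in_hole j p q u"
  shows "spread m z (antipode j p q u) = spread m z u"
proof -
  have "cantor m (2 * r + 3 ^ j - x - y) = cantor m (x - y)"
    if "central M j r" "3 ^ m dvd y" "r \<le> x" "x \<le> r + 3 ^ j" for r x y
  proof -
    have "(3::int) ^ (j + 1) dvd 3 ^ m" using assms(3) by (intro le_imp_power_dvd) simp
    then have "3 ^ (j + 1) dvd y" using that(2) by (rule dvd_trans)
    moreover have "3 ^ (j + 1) dvd r - 3 ^ j" using that(1) by (simp add: central_def)
    ultimately have "3 ^ (j + 1) dvd (r - 3 ^ j) - y" by (rule dvd_diff [rotated])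
    then have d: "3 ^ (j + 1) dvd (r - y) - 3 ^ j" by (simp add: algebra_simps)
    have "cantor m ((r - y) + (r + 3 ^ j - x)) = cantor m (r - y)"
      "cantor m ((r - y) + (x - r)) = cantor m (r - y)"
      using that(3,4) by (intro cantor_const [OF assms(3) d]; simp)+
    moreover have "(r - y) + (r + 3 ^ j - x) = 2 * r + 3 ^ j - x - y" "(r - y) + (x - r) = x - y"
      by simp_all
    ultimately show ?thesis by (simp only:)
  qed
  then show ?thesis
    using assms(1,2,4,5) by (simp add: spread_def antipode_def in_hole_def on_grid_def)
qed

text \<open>The sides of the square lie on the grid.  A grid point outside it is, in some coordinate, at least
  one grid step beyond the sides, and hence that far from every point of the square.\<close>

lemma spread_large_hole:
  assumes "m \<le> j" "vacant M j p q" "in_hole j p q u" "on_grid m z" "\<not> in_hole j p q z"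
  shows "spread m z u = 2 ^ m"
proof -
  have far: "3 ^ m \<le> \<bar>x - y\<bar>" if "3 ^ m dvd x" "3 ^ m dvd y" "x \<noteq> y" for x y :: int
    using dvd_imp_le_int [of "x - y" "3 ^ m"] that by (simp add: dvd_diff)
  have outside: "3 ^ m \<le> \<bar>x - y\<bar>"
    if "3 ^ m dvd r" "3 ^ m dvd y" "r \<le> x" "x \<le> r + 3 ^ j" "\<not> (r \<le> y \<and> y \<le> r + 3 ^ j)" for r x y :: int
  proof -
    have "(3::int) ^ m dvd 3 ^ j" using assms(1) by (intro le_imp_power_dvd)
    then have "3 ^ m \<le> \<bar>r - y\<bar>" "3 ^ m \<le> \<bar>r + 3 ^ j - y\<bar>"
      using that by (intro far dvd_add; auto)+
    then show ?thesis using that(3-5) by linarith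
  qed
  have d: "3 ^ m dvd p" "3 ^ m dvd q" "(3::int) ^ m dvd 3 ^ j"
  proof -
    have "(3::int) ^ m dvd 3 ^ (j + 1)" and 1: "(3::int) ^ m dvd 3 ^ j"
      using assms(1) by (intro le_imp_power_dvd; simp)+
    then have "3 ^ m dvd r" if "central M j r" for r
    proof -
      have "3 ^ m dvd (r - 3 ^ j) + 3 ^ j"
        using that 1 dvd_trans [OF \<open>3 ^ m dvd 3 ^ (j + 1)\<close>] by (intro dvd_add) (simp_all only: central_def)
      then show ?thesis by simp
    qed
    then show "3 ^ m dvd p" "3 ^ m dvd q" "(3::int) ^ m dvd 3 ^ j"
      using assms(2) 1 by (auto simp: vacant_iff_digits)
  qed
  have in_u: "p \<le> fst u" "fst u \<le> p + 3 ^ j" "q \<le> snd u" "snd u \<le> q + 3 ^ j"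
    using assms(3) by (auto simp: in_hole_def)
  have z: "3 ^ m dvd fst z" "3 ^ m dvd snd z" using assms(4) by (auto simp: on_grid_def)
  have "3 ^ m \<le> \<bar>fst u - fst z\<bar> \<or> 3 ^ m \<le> \<bar>snd u - snd z\<bar>"
  proof (cases "p \<le> fst z \<and> fst z \<le> p + 3 ^ j")
    case False
    then show ?thesis using outside [OF d(1) z(1) in_u(1,2)] by simp
  next
    case True
    then have "\<not> (q \<le> snd z \<and> snd z \<le> q + 3 ^ j)" using assms(5) by (simp add: in_hole_def)
    then show ?thesis using outside [OF d(2) z(2) in_u(3,4)] by simp
  qed
  then have "cantor m (fst u - fst z) = 2 ^ m \<or> cantor m (snd u - snd z) = 2 ^ m"
    using cantor_far by blast
  then show ?thesis using cantor_le [of m] by (auto simp: spread_def max_def intro: order_antisym)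
qed

text \<open>A finite set of grid points that is closed under the reflections of all vacant squares it meets;
  closure is what makes the potential well defined on the glued complex.\<close>

locale sources =
  fixes M m :: nat and Z :: "(int \<times> int) set"
  assumes finite_Z: "finite Z" and nonempty: "Z \<noteq> {}"
    and grid: "z \<in> Z \<Longrightarrow> on_grid m z"
    and closed: "z \<in> Z \<Longrightarrow> vacant M j p q \<Longrightarrow> in_hole j p q z \<Longrightarrow> antipode j p q z \<in> Z"
begin

lemma potential_le_spread: "z \<in> Z \<Longrightarrow> potential m Z u \<le> spread m z u"
  unfolding potential_def using finite_Z by (intro Min_le) auto

lemma potential_attained: obtains z where "z \<in> Z" "potential m Z u = spread m z u"
proof -
  have "potential m Z u \<in> (\<lambda>z. spread m z u) ` Z"
    unfolding potential_def using finite_Z nonempty by (intro Min_in) auto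
  then show ?thesis using that by blast
qed

text \<open>For a small vacant square no term of the minimum changes.  For a large one, a minimizing \<open>z\<close> in the
  square may be reflected along with \<open>u\<close>, and a minimizing \<open>z\<close> outside gives the maximal value.\<close>

lemma potential_antipode_le:
  assumes "vacant M j p q" "in_hole j p q u"
  shows "potential m Z (antipode j p q u) \<le> potential m Z u"
proof -
  obtain z where z: "z \<in> Z" "potential m Z u = spread m z u" by (rule potential_attained)
  have c: "central M j p" "central M j q" using assms(1) by (auto simp: vacant_iff_digits)
  consider "j < m" | "m \<le> j" "in_hole j p q z" | "m \<le> j" "\<not> in_hole j p q z" by linarith
  then show ?thesis
  proof cases
    case 1
    then show ?thesis
      using potential_le_spread [OF z(1), of "antipode j p q u"] z(2) assms(2)
        spread_small_hole [OF c 1 grid [OF z(1)], of u] by simp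
  next
    case 2
    then show ?thesis
      using potential_le_spread [OF closed [OF z(1) assms(1) 2(2)], of "antipode j p q u"] z(2)
      by (simp add: spread_antipode)
  next
    case 3
    then have "potential m Z u = 2 ^ m"
      using spread_large_hole [OF 3(1) assms grid [OF z(1)] 3(2)] z(2) by simp
    then show ?thesis
      using potential_le_spread [OF z(1), of "antipode j p q u"] spread_le [of m z] by (metis order_trans)
  qed
qed

lemma potential_antipode:
  assumes "vacant M j p q" "in_hole j p q u"
  shows "potential m Z (antipode j p q u) = potential m Z u"
  using potential_antipode_le [OF assms] potential_antipode_le [OF assms(1), of "antipode j p q u"] assms(2)
  by simp

lemma potential_equivclp:
  assumes "equivclp (glue M) (point u) v"
  obtains w where "v = point w" "potential m Z w = potential m Z u"
proof -
  have "\<exists>w. v = point w \<and> potential m Z w = potential m Z u"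
    using assms
  proof (induction rule: equivclp_induct)
    case (step y z)
    then obtain w where w: "y = point w" "potential m Z w = potential m Z u" by blast
    from step.hyps(2) have "\<exists>j p q. vacant M j p q \<and> in_hole j p q w \<and> z = point (antipode j p q w)"
    proof
      assume "glue M y z"
      then show ?thesis by (rule glue_points [of _ _ _ w]) (use w in auto)
    next
      assume "glue M z y"
      then show ?thesis by (rule glue_points [of _ _ _ w]) (use w in auto)
    qed
    then show ?case using potential_antipode w by metis
  qed blast
  then show ?thesis using that by blast
qed

lemma potential_lipschitz:
  assumes "fst v - fst u \<in> {0, 1}" "snd v - snd u \<in> {0, 1}"
  shows "\<bar>potential m Z v - potential m Z u\<bar> \<le> 1"
proof -
  have "\<bar>cantor m (y - c) - cantor m (x - c)\<bar> \<le> 1" if "y - x \<in> {0, 1}" for x y c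
  proof -
    have "y = x \<or> y = x + 1" using that by auto
    then show ?thesis using cantor_step [of m "x - c"] by (auto simp: algebra_simps)
  qed
  then have "\<bar>cantor m (fst v - fst z) - cantor m (fst u - fst z)\<bar> \<le> 1"
    "\<bar>cantor m (snd v - snd z) - cantor m (snd u - snd z)\<bar> \<le> 1" for z
    using assms by blast+
  moreover have "\<bar>max a b - max a' b'\<bar> \<le> 1" if "\<bar>a - a'\<bar> \<le> 1" "\<bar>b - b'\<bar> \<le> 1" for a a' b b' :: int
    using that by (auto simp: max_def)
  ultimately have s: "\<bar>spread m z v - spread m z u\<bar> \<le> 1" for z
    unfolding spread_def by blast
  obtain z where z: "z \<in> Z" "potential m Z u = spread m z u" by (rule potential_attained)
  obtain w where w: "w \<in> Z" "potential m Z v = spread m w v" by (rule potential_attained)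
  show ?thesis
    using potential_le_spread [OF z(1), of v] potential_le_spread [OF w(1), of u] s [of z] s [of w] z(2) w(2)
    by linarith
qed

text \<open>Every edge of a cell \<open>c\<close> contains the lattice point \<open>c\<close> or \<open>c + (1, 1)\<close>.  On a shared edge this point
  is identified with a lattice point of the other cell, with the same potential; within each cell the
  potential varies by at most \<open>1\<close>.\<close>

lemma potential_adjV:
  assumes "adjV M c d"
  shows "\<bar>potential m Z d - potential m Z c\<bar> \<le> 2"
proof -
  obtain E F where EF: "E \<in> edges c" "F \<in> edges d" "quotient_map M ` E = quotient_map M ` F"
    using assms by (auto simp: adjV_def)
  have "point c \<in> E \<or> point (c + (1, 1)) \<in> E"
  proof -
    obtain a b where c: "c = (a, b)" by fastforce
    from EF(1) show ?thesis
      unfolding edges_def c prod.case by (elim insertE emptyE) (simp_all add: point_def)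
  qed
  then obtain u where u: "point u \<in> E" "u = c \<or> u = c + (1, 1)" by blast
  then obtain v where v: "v \<in> F" "equivclp (glue M) (point u) v"
    using EF(3) unfolding quotient_map_image_eq_iff by blast
  obtain w where w: "v = point w" "potential m Z w = potential m Z u"
    using potential_equivclp [OF v(2)] .
  have near: "k - l \<in> {0, 1}" if "of_int k \<in> {of_int l..of_int l + 1 :: real}" for k l
  proof -
    have "real_of_int l \<le> of_int k" "real_of_int k \<le> of_int (l + 1)" using that by simp_all
    then have "l \<le> k" "k \<le> l + 1" by (simp_all only: of_int_le_iff)
    then show ?thesis by auto
  qed
  obtain a b where d: "d = (a, b)" by fastforce
  have "of_int (fst w) \<in> {of_int a..of_int a + 1 :: real} \<and> of_int (snd w) \<in> {of_int b..of_int b + 1 :: real}"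
    using EF(2) v(1) unfolding w(1) edges_def d prod.case
    by (elim insertE emptyE) (simp_all add: point_def)
  then have "fst w - fst d \<in> {0, 1}" "snd w - snd d \<in> {0, 1}" using near by (simp_all only: d fst_conv snd_conv)
  then have "\<bar>potential m Z w - potential m Z d\<bar> \<le> 1"
    by (rule potential_lipschitz)
  moreover have "\<bar>potential m Z u - potential m Z c\<bar> \<le> 1"
    using u(2) by (intro potential_lipschitz) auto
  ultimately show ?thesis using w(2) by linarith
qed

lemma potential_path:
  "(adjV M ^^ n) c d \<Longrightarrow> \<bar>potential m Z d - potential m Z c\<bar> \<le> 2 * int n"
proof (induction n arbitrary: d)
  case (Suc n)
  then obtain b where b: "(adjV M ^^ n) c b" "adjV M b d" by auto
  show ?case using Suc.IH [OF b(1)] potential_adjV [OF b(2)] by simp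
qed simp

lemma potential_small:
  assumes "potential m Z u < 2 ^ m"
  obtains z where "z \<in> Z" "\<bar>fst u - fst z\<bar> < 3 ^ m" "\<bar>snd u - snd z\<bar> < 3 ^ m"
proof -
  obtain z where z: "z \<in> Z" "potential m Z u = spread m z u" by (rule potential_attained)
  have "cantor m (fst u - fst z) \<noteq> 2 ^ m" "cantor m (snd u - snd z) \<noteq> 2 ^ m"
    using assms z(2) by (auto simp: spread_def)
  then have "\<not> 3 ^ m \<le> \<bar>fst u - fst z\<bar>" "\<not> 3 ^ m \<le> \<bar>snd u - snd z\<bar>"
    using cantor_far by blast+
  then show ?thesis using that [OF z(1)] by simp
qed

end

section \<open>Counting cells near a given cell\<close>

lemma cells_bounds: "c \<in> cells m \<Longrightarrow> 0 \<le> fst c \<and> fst c < 3 ^ m \<and> 0 \<le> snd c \<and> snd c < 3 ^ m"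
  by (auto simp: cells_def)

lemma cells_Suc: "cells (Suc m) = (\<lambda>(d, e). d + offset m e) ` (cells m \<times> positions)"
proof
  show "cells (Suc m) \<subseteq> (\<lambda>(d, e). d + offset m e) ` (cells m \<times> positions)"
  proof
    fix c assume "c \<in> cells (Suc m)"
    then obtain d e where "c = d + offset m e" "d \<in> cells m" "e \<in> positions" by (rule cells_SucE)
    then show "c \<in> (\<lambda>(d, e). d + offset m e) ` (cells m \<times> positions)" by (intro image_eqI [of _ _ "(d, e)"]) auto
  qed
  show "(\<lambda>(d, e). d + offset m e) ` (cells m \<times> positions) \<subseteq> cells (Suc m)"
    using cells_embed by auto
qed

lemma inj_on_offset: "inj_on (\<lambda>(d, e). d + offset m e) (cells m \<times> positions)"
proof (rule inj_onI)
  fix p p' :: "cell \<times> (int \<times> int)"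
  assume p: "p \<in> cells m \<times> positions" "p' \<in> cells m \<times> positions"
    and eq: "(case p of (d, e) \<Rightarrow> d + offset m e) = (case p' of (d, e) \<Rightarrow> d + offset m e)"
  obtain a b i l a' b' i' l' where c: "p = ((a, b), (i, l))" "p' = ((a', b'), (i', l'))"
    by (metis prod.exhaust)
  have ab: "a + 3 ^ m * i = a' + 3 ^ m * i'" "b + 3 ^ m * l = b' + 3 ^ m * l'"
    using eq by (simp_all add: c offset_def)
  have r: "x = y \<and> i = i'" if "x + 3 ^ m * i = y + 3 ^ m * i'" "0 \<le> x" "x < 3 ^ m" "0 \<le> y" "y < 3 ^ m"
    for x y i i' :: int
    using that digit_shift_top [of x m i] digit_shift_top [of y m i'] by simp
  show "p = p'"
    using r [OF ab(1)] r [OF ab(2)] cells_bounds [of "(a, b)" m] cells_bounds [of "(a', b')" m] p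
    by (simp add: c)
qed

lemma card_cells: "finite (cells m) \<and> card (cells m) = 8 ^ m"
proof (induction m)
  case 0
  have "cells 0 = {(0, 0)}" by (auto simp: cells_def)
  then show ?case by simp
next
  case (Suc m)
  have "card positions = 8" by (simp add: card_cartesian_product)
  then show ?case
    using Suc unfolding cells_Suc card_image [OF inj_on_offset] by (simp add: card_cartesian_product)
qed

lemma card_block_le:
  assumes "m \<le> M"
  shows "card {y \<in> cells M. fst y div 3 ^ m = U \<and> snd y div 3 ^ m = V} \<le> 8 ^ m"
proof -
  let ?B = "{y \<in> cells M. fst y div 3 ^ m = U \<and> snd y div 3 ^ m = V}"
  let ?f = "\<lambda>y. (fst y mod 3 ^ m, snd y mod 3 ^ m) :: int \<times> int"
  have "card ?B \<le> card (cells m)"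
  proof (rule card_inj_on_le)
    show "inj_on ?f ?B"
    proof (rule inj_onI)
      fix y z assume "y \<in> ?B" "z \<in> ?B" "?f y = ?f z"
      then have "fst y = fst z" "snd y = snd z"
        using mult_div_mod_eq [of "3 ^ m" "fst y"] mult_div_mod_eq [of "3 ^ m" "fst z"]
          mult_div_mod_eq [of "3 ^ m" "snd y"] mult_div_mod_eq [of "3 ^ m" "snd z"] by simp_all
      then show "y = z" by (rule prod_eqI)
    qed
    show "?f ` ?B \<subseteq> cells m" using assms by (auto simp: cells_def digit_mod)
  qed (simp add: card_cells)
  then show ?thesis by (simp add: card_cells)
qed

lemma card_near_le:
  assumes "m \<le> M" "on_grid m z"
  shows "card {y \<in> cells M. \<bar>fst y - fst z\<bar> < 3 ^ m \<and> \<bar>snd y - snd z\<bar> < 3 ^ m} \<le> 4 * 8 ^ m"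
proof -
  define u v where "u = fst z div 3 ^ m" and "v = snd z div 3 ^ m"
  have uv: "fst z = 3 ^ m * u" "snd z = 3 ^ m * v"
    using assms(2) by (simp_all add: on_grid_def u_def v_def)
  let ?B = "\<lambda>(U, V). {y \<in> cells M. fst y div 3 ^ m = U \<and> snd y div 3 ^ m = V}"
  let ?I = "{u - 1, u} \<times> {v - 1, v}"
  have d: "x div 3 ^ m \<in> {k - 1, k}" if "\<bar>x - 3 ^ m * k\<bar> < 3 ^ m" for x k :: int
  proof (cases "3 ^ m * k \<le> x")
    case True
    then have "x div 3 ^ m = k"
      using that by (intro int_div_pos_eq [of _ _ _ "x - 3 ^ m * k"]) auto
    then show ?thesis by simp
  next
    case False
    then have "x div 3 ^ m = k - 1"
      using that by (intro int_div_pos_eq [of _ _ _ "x - 3 ^ m * (k - 1)"]) (auto simp: right_diff_distrib)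
    then show ?thesis by simp
  qed
  have "{y \<in> cells M. \<bar>fst y - fst z\<bar> < 3 ^ m \<and> \<bar>snd y - snd z\<bar> < 3 ^ m} \<subseteq> (\<Union>i\<in>?I. ?B i)"
  proof
    fix y assume y: "y \<in> {y \<in> cells M. \<bar>fst y - fst z\<bar> < 3 ^ m \<and> \<bar>snd y - snd z\<bar> < 3 ^ m}"
    then have "(fst y div 3 ^ m, snd y div 3 ^ m) \<in> ?I" using d unfolding uv by blast
    moreover have "y \<in> ?B (fst y div 3 ^ m, snd y div 3 ^ m)" using y by simp
    ultimately show "y \<in> (\<Union>i\<in>?I. ?B i)" by (rule UN_I)
  qed
  moreover have "finite (\<Union>i\<in>?I. ?B i)"
    by (rule finite_subset [OF _ conjunct1 [OF card_cells [of M]]]) auto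
  ultimately have "card {y \<in> cells M. \<bar>fst y - fst z\<bar> < 3 ^ m \<and> \<bar>snd y - snd z\<bar> < 3 ^ m} \<le> card (\<Union>i\<in>?I. ?B i)"
    by (intro card_mono)
  also have "\<dots> \<le> (\<Sum>i\<in>?I. card (?B i))" by (rule card_UN_le) simp
  also have "\<dots> \<le> (\<Sum>i\<in>?I. 8 ^ m)" by (intro sum_mono) (auto intro: card_block_le [OF assms(1)])
  also have "\<dots> = 4 * 8 ^ m" by (simp add: card_cartesian_product)
  finally show ?thesis .
qed

text \<open>The sources are the corners of the block of \<open>x\<close> with their reflected partners.  In each coordinate
  the distance of \<open>x\<close> from the nearer wall of the block has staircase height at most \<open>2\<^sup>m / 2\<close>, so
  the potential at \<open>x\<close> is at
  most \<open>2\<^sup>m / 2\<close>, and fewer than \<open>2\<^sup>m / 4\<close> steps of at most \<open>2\<close> cannot raise it to \<open>2\<^sup>m\<close>.\<close>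

lemma card_reachable_le:
  assumes "m \<le> M"
  shows "card {y \<in> cells M. \<exists>n. 4 * n < 2 ^ m \<and> (adjV M ^^ n) x y} \<le> 32 * 8 ^ m"
proof -
  obtain a b where x: "x = (a, b)" by fastforce
  define node where "node = (\<lambda>(s, t). (3 ^ m * (a div 3 ^ m + s), 3 ^ m * (b div 3 ^ m + t)))"
  define S where "S = {0, 1 :: int} \<times> {0, 1 :: int}"
  define Z where "Z = (\<Union>i\<in>S. orbit M (node i))"
  have "finite Z" unfolding Z_def S_def using orbit_small by auto
  have grid: "on_grid m z" if "z \<in> Z" for z
  proof -
    obtain i where i: "i \<in> S" "z \<in> orbit M (node i)" using \<open>z \<in> Z\<close> by (auto simp: Z_def)
    have "on_grid m (node i)" by (simp add: on_grid_def node_def split: prod.split)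
    then show ?thesis using i(2) by (rule orbit_on_grid)
  qed
  have node_in: "node i \<in> Z" if "i \<in> S" for i
    using that unfolding Z_def by (rule UN_I) (simp add: orbit_def)
  interpret sources M m Z
  proof
    show "finite Z" by fact
    show "Z \<noteq> {}" using node_in [of "(0, 0)"] by (auto simp: S_def)
    show "on_grid m z" if "z \<in> Z" for z using that by (rule grid)
    show "antipode j p q z \<in> Z" if "z \<in> Z" "vacant M j p q" "in_hole j p q z" for j p q z
    proof -
      obtain i where i: "i \<in> S" "z \<in> orbit M (node i)" using \<open>z \<in> Z\<close> unfolding Z_def by (rule UN_E)
      show ?thesis unfolding Z_def using orbit_closed [OF i(2) that(2,3)] i(1) by (rule UN_I [rotated])
    qed
  qed
  have near: "\<exists>s\<in>{0, 1}. 2 * cantor m (k - 3 ^ m * (k div 3 ^ m + s)) \<le> 2 ^ m" for k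
  proof -
    have 0: "k - 3 ^ m * (k div 3 ^ m + 0) = k mod 3 ^ m"
      and 1: "k - 3 ^ m * (k div 3 ^ m + 1) = - (3 ^ m - k mod 3 ^ m)"
      using minus_mult_div_eq_mod [of k "3 ^ m"] by (simp_all add: distrib_left)
    have "cantor m (k mod 3 ^ m) + cantor m (3 ^ m - k mod 3 ^ m) = 2 ^ m"
      by (intro cantor_complement) (simp_all add: less_imp_le)
    then have "2 * cantor m (k - 3 ^ m * (k div 3 ^ m + 0)) \<le> 2 ^ m \<or>
        2 * cantor m (k - 3 ^ m * (k div 3 ^ m + 1)) \<le> 2 ^ m"
      unfolding 0 1 cantor_minus by linarith
    then show ?thesis by blast
  qed
  obtain s t where st: "s \<in> {0, 1}" "2 * cantor m (a - 3 ^ m * (a div 3 ^ m + s)) \<le> 2 ^ m"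
    "t \<in> {0, 1}" "2 * cantor m (b - 3 ^ m * (b div 3 ^ m + t)) \<le> 2 ^ m"
    using near [of a] near [of b] by blast
  have "2 * spread m (node (s, t)) x \<le> 2 ^ m"
    using st(2,4) by (simp add: spread_def node_def x max_def)
  moreover have "(s, t) \<in> S" unfolding S_def using st(1,3) by (rule SigmaI)
  ultimately have x_low: "2 * potential m Z x \<le> 2 ^ m"
    using potential_le_spread [OF node_in, of "(s, t)" x] by simp
  let ?N = "\<lambda>z. {y \<in> cells M. \<bar>fst y - fst z\<bar> < 3 ^ m \<and> \<bar>snd y - snd z\<bar> < 3 ^ m}"
  have "{y \<in> cells M. \<exists>n. 4 * n < 2 ^ m \<and> (adjV M ^^ n) x y} \<subseteq> (\<Union>z\<in>Z. ?N z)"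
  proof clarify
    fix c d n assume y: "(c, d) \<in> cells M" "4 * n < 2 ^ m" "(adjV M ^^ n) x (c, d)"
    have "int (4 * n) < int (2 ^ m)" using y(2) by (simp only: of_nat_less_iff)
    then have "4 * int n < 2 ^ m" by simp
    then have "potential m Z (c, d) < 2 ^ m" using potential_path [OF y(3)] x_low by linarith
    then obtain z where "z \<in> Z" "\<bar>fst (c, d) - fst z\<bar> < 3 ^ m" "\<bar>snd (c, d) - snd z\<bar> < 3 ^ m"
      by (rule potential_small)
    then show "(c, d) \<in> (\<Union>z\<in>Z. ?N z)" using y(1) by blast
  qed
  moreover have "finite (\<Union>z\<in>Z. ?N z)"
    by (rule finite_subset [OF _ conjunct1 [OF card_cells [of M]]]) auto
  ultimately have "card {y \<in> cells M. \<exists>n. 4 * n < 2 ^ m \<and> (adjV M ^^ n) x y} \<le> card (\<Union>z\<in>Z. ?N z)"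
    by (intro card_mono)
  also have "\<dots> \<le> (\<Sum>z\<in>Z. card (?N z))" by (rule card_UN_le) fact
  also have "\<dots> \<le> (\<Sum>z\<in>Z. 4 * 8 ^ m)" by (intro sum_mono card_near_le assms grid)
  also have "\<dots> = card Z * (4 * 8 ^ m)" by simp
  also have "card Z \<le> 8"
  proof -
    have "card Z \<le> (\<Sum>i\<in>S. card (orbit M (node i)))" unfolding Z_def by (rule card_UN_le) (simp add: S_def)
    also have "\<dots> \<le> (\<Sum>i\<in>S. 2)" by (intro sum_mono) (simp add: orbit_small)
    also have "\<dots> = 8" by (simp add: S_def card_cartesian_product)
    finally show ?thesis .
  qed
  finally show ?thesis by simp
qed

section \<open>Balls in the infinite magic carpet\<close>

context
  fixes e :: "nat \<Rightarrow> int \<times> int"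
  assumes choice: "embedding_choice e"
begin

lemma choice_position: "e m \<in> positions"
  using choice unfolding embedding_choice_def by blast

lemma diff_origin_Suc: "x - origin e (Suc m) = x - origin e m + offset m (e m)"
  by (simp add: origin_def offset_def)

lemma cells_mono:
  assumes "m \<le> k" "x - origin e m \<in> cells m"
  shows "x - origin e k \<in> cells k"
  using assms
proof (induction rule: dec_induct)
  case (step k)
  then show ?case unfolding diff_origin_Suc using cells_embed [OF choice_position] by blast
qed

lemma path_mono:
  assumes "m \<le> k" "(adjV m ^^ n) (x - origin e m) (y - origin e m)"
  shows "(adjV k ^^ n) (x - origin e k) (y - origin e k)"
  using assms
proof (induction rule: dec_induct)
  case (step k)
  then show ?case unfolding diff_origin_Suc using relpowp_embed [OF choice_position] by blast
qed

text \<open>A finite path uses adjacencies from finitely many stages, hence lies in a single one.\<close>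

lemma path_IMC_imp:
  assumes "(adjIMC e ^^ n) x y"
  shows "\<exists>m. (adjV m ^^ n) (x - origin e m) (y - origin e m)"
  using assms
proof (induction n arbitrary: y)
  case 0
  then show ?case by simp
next
  case (Suc n)
  then obtain z where z: "(adjIMC e ^^ n) x z" "adjIMC e z y" by auto
  obtain m where m: "(adjV m ^^ n) (x - origin e m) (z - origin e m)" using Suc.IH [OF z(1)] ..
  obtain k where k: "adjV k (z - origin e k) (y - origin e k)" using z(2) by (auto simp: adjIMC_def)
  let ?k = "max m k"
  have "(adjV ?k ^^ n) (x - origin e ?k) (z - origin e ?k)" using path_mono [OF _ m] by simp
  moreover have "adjV ?k (z - origin e ?k) (y - origin e ?k)"
    using path_mono [of k ?k 1 z y] k by (simp add: eq_OO)
  ultimately show ?case by (intro exI [of _ ?k] relpowp_Suc_I)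
qed

lemma path_imp_path_IMC:
  assumes "(adjV m ^^ n) (x - origin e m) c"
  shows "(adjIMC e ^^ n) x (c + origin e m)"
  using assms
proof (induction n arbitrary: c)
  case 0
  then have "x - origin e m = c" by simp
  then have "x = c + origin e m" by (metis diff_add_cancel)
  then show ?case by simp
next
  case (Suc n)
  then obtain b where b: "(adjV m ^^ n) (x - origin e m) b" "adjV m b c" by auto
  have "adjIMC e (b + origin e m) (c + origin e m)"
    unfolding adjIMC_def using b(2) by (intro exI [of _ m]) simp
  then show ?case using Suc.IH [OF b(1)] by (intro relpowp_Suc_I)
qed

lemma ballIMC_iff:
  "y \<in> ballIMC e x r \<longleftrightarrow> y \<in> IMC e \<and> (\<exists>n. real n < r \<and> (adjIMC e ^^ n) x y)"
proof -
  let ?P = "\<lambda>n. (adjIMC e ^^ n) x y"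
  have "ereal_of_enat (distIMC e x y) < ereal r \<longleftrightarrow> (\<exists>n. real n < r \<and> ?P n)"
  proof (cases "\<exists>n. ?P n")
    case False
    then have "distIMC e x y = \<infinity>" by (simp add: distIMC_def top_enat_def)
    then show ?thesis using False by simp
  next
    case True
    define k where "k = (LEAST n. ?P n)"
    have k: "?P k" unfolding k_def using True by (rule LeastI_ex)
    have min: "k \<le> n" if "?P n" for n unfolding k_def using that by (rule Least_le)
    have "distIMC e x y = enat k"
      unfolding distIMC_def using k min by (intro antisym INF_lower INF_greatest) auto
    moreover have "(\<exists>n. real n < r \<and> ?P n) \<longleftrightarrow> real k < r"
    proof
      assume "\<exists>n. real n < r \<and> ?P n"
      then obtain n where n: "real n < r" "?P n" by blast
      have "real k \<le> real n" using min [OF n(2)] by simp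
      then show "real k < r" using n(1) by linarith
    qed (use k in blast)
    ultimately show ?thesis by simp
  qed
  then show ?thesis by (simp add: ballIMC_def)
qed

text \<open>The stage in which a cell of the ball is reached depends on the cell.  A finite subset of the ball has
  a common stage, where the count holds with a bound independent of the stage; so the ball itself is
  finite and obeys the same bound.\<close>

lemma card_ball_le:
  assumes "4 * r \<le> 2 ^ m"
  shows "finite (ballIMC e x r) \<and> card (ballIMC e x r) \<le> 32 * 8 ^ m"
proof (rule finite_if_finite_subsets_card_bdd)
  fix F assume F: "F \<subseteq> ballIMC e x r" "finite F"
  have "\<exists>k\<ge>m. y - origin e k \<in> cells k \<and>
      (\<exists>n. 4 * n < 2 ^ m \<and> (adjV k ^^ n) (x - origin e k) (y - origin e k))" if "y \<in> F" for y
  proof -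
    have "y \<in> ballIMC e x r" using that F(1) by blast
    then obtain n where n: "y \<in> IMC e" "real n < r" "(adjIMC e ^^ n) x y"
      unfolding ballIMC_iff by blast
    obtain i where i: "y - origin e i \<in> cells i" using n(1) by (auto simp: IMC_def)
    obtain j where j: "(adjV j ^^ n) (x - origin e j) (y - origin e j)" using path_IMC_imp [OF n(3)] ..
    let ?k = "max m (max i j)"
    have "real (4 * n) < real (2 ^ m)" using n(2) assms by simp
    then have "4 * n < 2 ^ m" by (simp only: of_nat_less_iff)
    then show ?thesis
      using cells_mono [OF _ i, of ?k] path_mono [OF _ j, of ?k] by (intro exI [of _ ?k]) auto
  qed
  then obtain k where k: "\<And>y. y \<in> F \<Longrightarrow> m \<le> k y \<and> y - origin e (k y) \<in> cells (k y) \<and>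
      (\<exists>n. 4 * n < 2 ^ m \<and> (adjV (k y) ^^ n) (x - origin e (k y)) (y - origin e (k y)))"
    by metis
  define M where "M = Max (insert m (k ` F))"
  have M: "m \<le> M" "\<And>y. y \<in> F \<Longrightarrow> k y \<le> M" using F(2) by (auto simp: M_def)
  let ?R = "{y \<in> cells M. \<exists>n. 4 * n < 2 ^ m \<and> (adjV M ^^ n) (x - origin e M) y}"
  have "(\<lambda>y. y - origin e M) ` F \<subseteq> ?R"
  proof (rule image_subsetI)
    fix y assume y: "y \<in> F"
    then obtain n where "4 * n < 2 ^ m" "(adjV (k y) ^^ n) (x - origin e (k y)) (y - origin e (k y))"
      using k by blast
    then show "y - origin e M \<in> ?R"
      using cells_mono [OF M(2) [OF y]] path_mono [OF M(2) [OF y]] k [OF y] by blast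
  qed
  moreover have "finite ?R" by (rule finite_subset [OF _ conjunct1 [OF card_cells [of M]]]) auto
  ultimately have "card F \<le> card ?R" by (intro card_inj_on_le) (auto simp: inj_on_def)
  also have "\<dots> \<le> 32 * 8 ^ m" by (rule card_reachable_le [OF M(1)])
  finally show "card F \<le> 32 * 8 ^ m" .
qed

lemma card_ball_ge:
  assumes "x - origin e m \<in> cells m" "56 * 2 ^ m < r" "finite (ballIMC e x r)"
  shows "8 ^ m \<le> card (ballIMC e x r)"
proof -
  have "(\<lambda>c. c + origin e m) ` cells m \<subseteq> ballIMC e x r"
  proof (rule image_subsetI)
    fix c assume c: "c \<in> cells m"
    obtain n where n: "n \<le> 56 * 2 ^ m" "(adjV m ^^ n) (x - origin e m) c"
      using diameter_le [OF assms(1) c] by (auto simp: linked_def)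
    have "real n \<le> real (56 * 2 ^ m)" using n(1) by (simp only: of_nat_le_iff)
    then have "real n < r" using assms(2) by simp
    moreover have "c + origin e m \<in> IMC e" unfolding IMC_def using c by (auto intro!: exI [of _ m])
    ultimately show "c + origin e m \<in> ballIMC e x r"
      using path_imp_path_IMC [OF n(2)] by (auto simp: ballIMC_iff)
  qed
  then have "card (cells m) \<le> card (ballIMC e x r)"
    using assms(3) by (intro card_inj_on_le) (auto simp: inj_on_def)
  then show ?thesis by (simp add: card_cells)
qed

end

lemma dyadic_bracket:
  fixes s :: real
  assumes "1 < s"
  obtains m where "2 ^ m < s" "s \<le> 2 ^ Suc m"
proof -
  define k where "k = (LEAST k. s \<le> 2 ^ k)"
  have "\<exists>k. s \<le> 2 ^ k" using real_arch_pow [of 2 s] by (auto intro: less_imp_le)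
  then have k: "s \<le> 2 ^ k" unfolding k_def by (rule LeastI_ex)
  then obtain m where m: "k = Suc m" using assms by (cases k) auto
  then have "\<not> s \<le> 2 ^ m" using not_less_Least [of m "\<lambda>k. s \<le> 2 ^ k"] by (simp add: k_def)
  then have "2 ^ m < s" by simp
  then show ?thesis using that k unfolding m by blast
qed

theorem theorem2p21:
  fixes e :: "nat \<Rightarrow> int \<times> int" and x :: cell
  assumes "embedding_choice e"
    and "generic e"
    and "x \<in> IMC e"
  shows "\<exists>c C :: real. 0 < c \<and> 0 < C \<and>
    (\<forall>\<^sub>F r :: real in at_top.
       c * (r / ln r) ^ 3 \<le> real (card (ballIMC e x r)) \<and>
       real (card (ballIMC e x r)) \<le> C * r ^ 3)"
proof -
  obtain m\<^sub>0 where m\<^sub>0: "x - origin e m\<^sub>0 \<in> cells m\<^sub>0" using assms(3) by (auto simp: IMC_def)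
  have eight: "(8::real) ^ m = (2 ^ m) ^ 3" for m
  proof -
    have "((2::real) ^ m) ^ 3 = (2 ^ 3) ^ m" by (simp only: power_mult [symmetric] mult.commute)
    then show ?thesis by simp
  qed
  \<comment> \<open>The radius is bracketed between consecutive powers of \<open>2\<close>, up to a factor.  Below, the diameter
    constant \<open>56\<close> doubles to \<open>112\<close>; above, \<open>2\<^sup>k < 4 r\<close> turns \<open>32 \<cdot> 8\<^sup>k\<^sup>+\<^sup>1\<close> into \<open>32 \<cdot> 8 \<cdot> 4\<^sup>3 r\<^sup>3\<close>.\<close>
  have bounds: "1 / 112 ^ 3 * (r / ln r) ^ 3 \<le> real (card (ballIMC e x r)) \<and>
       real (card (ballIMC e x r)) \<le> 16384 * r ^ 3"
    if r: "exp 1 \<le> r" "56 * 2 ^ Suc m\<^sub>0 < r" for r :: real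
  proof
    have "1 \<le> ln r" using r(1) exp_gt_zero [of 1] by (subst ln_ge_iff) linarith+
    have "1 < r" using r(1) exp_ge_add_one_self [of 1] by linarith
    then have "1 < 4 * r" by simp
    then obtain k where k: "2 ^ k < 4 * r" "4 * r \<le> 2 ^ Suc k" by (rule dyadic_bracket)
    note ball = card_ball_le [OF assms(1) k(2), of x]
    have "real (card (ballIMC e x r)) \<le> real (32 * 8 ^ Suc k)"
      using ball by (simp only: of_nat_le_iff)
    also have "\<dots> = 256 * (2 ^ k) ^ 3" by (simp add: eight)
    also have "\<dots> \<le> 256 * (4 * r) ^ 3" using k(1) by (intro mult_left_mono power_mono) auto
    also have "\<dots> = 16384 * r ^ 3" by (simp add: power_mult_distrib)
    finally show "real (card (ballIMC e x r)) \<le> 16384 * r ^ 3" .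
    have "(1::real) \<le> 2 ^ Suc m\<^sub>0" by (rule one_le_power) simp
    then have "1 < r / 56" using r(2) by linarith
    then obtain m where m: "2 ^ m < r / 56" "r / 56 \<le> 2 ^ Suc m" by (rule dyadic_bracket)
    have "(2::real) ^ Suc m\<^sub>0 < 2 ^ Suc m" using r(2) m(2) by linarith
    then have "Suc m\<^sub>0 < Suc m" by (rule power_less_imp_less_exp [rotated]) simp
    then have "m\<^sub>0 \<le> m" by simp
    then have "8 ^ m \<le> card (ballIMC e x r)"
      using m(1) ball by (intro card_ball_ge [OF assms(1) cells_mono [OF assms(1) _ m\<^sub>0]]) auto
    then have "real (8 ^ m) \<le> real (card (ballIMC e x r))" by (simp only: of_nat_le_iff)
    then have card: "(2 ^ m) ^ 3 \<le> real (card (ballIMC e x r))" by (simp add: eight)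
    have "r / ln r \<le> r / 1" using \<open>1 \<le> ln r\<close> \<open>1 < r\<close> by (intro divide_left_mono) auto
    also have "\<dots> \<le> 112 * 2 ^ m" using m(2) by simp
    finally have "(r / ln r) ^ 3 \<le> (112 * 2 ^ m) ^ 3"
      using \<open>1 \<le> ln r\<close> \<open>1 < r\<close> by (intro power_mono) auto
    then have "1 / 112 ^ 3 * (r / ln r) ^ 3 \<le> (2 ^ m) ^ 3"
      unfolding power_mult_distrib by simp
    then show "1 / 112 ^ 3 * (r / ln r) ^ 3 \<le> real (card (ballIMC e x r))" using card by linarith
  qed
  show ?thesis
  proof (intro exI conjI)
    show "\<forall>\<^sub>F r in at_top. 1 / 112 ^ 3 * (r / ln r) ^ 3 \<le> real (card (ballIMC e x r)) \<and>
       real (card (ballIMC e x r)) \<le> 16384 * r ^ 3"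
      using eventually_ge_at_top [of "exp 1"] eventually_gt_at_top [of "56 * 2 ^ Suc m\<^sub>0"]
      by eventually_elim (rule bounds)
  qed simp_all
qed

end
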